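(* Let $h\colon\mathbb{N}\to[1,\infty)$ with $h(n)\to\infty$ and let $M_n=M_n^{(p_k,z_k)_k}$ be the randomized algorithm defined in the context. Let $\alpha>1/2$, let $\gamma=(\gamma_u)_u$ be weights with $0<\gamma_u\le1$, $d\in\mathbb{N}$, $\lambda\in(1/2,\alpha)$ and $\delta\in(0,\min\{\lambda-1/2,1\})$. Then there is a constant $C_{\lambda,\delta}>0$ depending only on $\lambda,\delta$ such that for all $f\in\mathcal{H}_{d,\alpha,\gamma}$ and all $n$ with $n\ge64\,V_d(\alpha/\lambda,\gamma^{1/\lambda})$ and $h(n)\ge\lambda+1/2$, $$\mathbb{E}\,|I_d(f)-M_n^{(p_k,z_k)_k}(f)|\le C_{\lambda,\delta}\,V_d(\alpha/\lambda,\gamma^{1/\lambda})^{\lambda}\,n^{-\lambda-1/2+\delta}\,\|f\|_{d,\alpha,\gamma}.$$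
   Context: $\{1:m\}:=\{1,\ldots,m\}$. Weights $\gamma=(\gamma_u)_u$ indexed by finite $u\subset\mathbb{N}$, $0<\gamma_u\le1$, $\gamma_\emptyset=1$. For $h\in\mathbb{Z}^d$, $\mathrm{supp}(h)=\{j:h_j\ne0\}$, $r_{d,\alpha,\gamma}(h)=\gamma_{\mathrm{supp}(h)}^{-1}\prod_{j\in\mathrm{supp}(h)}|h_j|^\alpha$. The weighted Korobov space $\mathcal{H}_{d,\alpha,\gamma}$ consists of $f\colon[0,1]^d\to\mathbb{C}$ with absolutely convergent Fourier series $f=\sum_h\hat f(h)e^{2\pi ih\cdot x}$ and finite norm $\|f\|_{d,\alpha,\gamma}^2=\sum_h r_{d,\alpha,\gamma}(h)^2|\hat f(h)|^2$. $I_d(f)=\int_{[0,1]^d}f$. Lattice rule $Q_p^z(f)=\frac1p\sum_{k=0}^{p-1}f(\{kz/p\})$ with $\{\cdot\}$ the componentwise fractional part. $V_d(\alpha/\lambda,\gamma^{1/\lambda})=\sum_{\emptyset\ne u\subseteq\{1:d\}}\gamma_u^{1/\lambda}(2\zeta(\alpha/\lambda))^{|u|}$ with $\zeta$ the Riemann zeta function. Algorithm: $\mathcal{P}_n$ is the set of primes in $[\lceil n/2\rceil+1,n]$; $N=2\lceil h(n)\log_2 n\rceil+1$. For $k=1,\ldots,N$ independently, choose $p_k$ uniformly from $\mathcal{P}_n$ and then $z_k$ uniformly from $\{1:p_k-1\}^d$; set $M_n^{(p_k,z_k)_k}(f)=\mathrm{median}\{Q_{p_k}^{z_k}(f):1\le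 k\le N\}$, where the median of complex numbers is taken separately for real and imaginary parts. The expectation is over $(p_k,z_k)_{k=1}^N$. *)

theory Defs
  imports "HOL-Probability.Probability"
begin

definition zeta_real :: "real \<Rightarrow> real" where
  "zeta_real s = (\<Sum>m. 1 / (real (Suc m)) powr s)"

definition Zd :: "nat \<Rightarrow> (nat \<Rightarrow> int) set" where
  "Zd d = {h. \<forall>j. j \<notin> {1..d} \<longrightarrow> h j = 0}"

definition supp :: "nat \<Rightarrow> (nat \<Rightarrow> int) \<Rightarrow> nat set" where
  "supp d h = {j \<in> {1..d}. h j \<noteq> 0}"

definition r_weight :: "nat \<Rightarrow> real \<Rightarrow> (nat set \<Rightarrow> real) \<Rightarrow> (nat \<Rightarrow> int) \<Rightarrow> real" where
  "r_weight d \<alpha> \<gamma> h = inverse (\<gamma> (supp d h)) * (\<Prod>j\<in>supp d h. \<bar>real_of_int (h j)\<bar> powr \<alpha>)"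

definition unit_cube :: "nat \<Rightarrow> (nat \<Rightarrow> real) measure" where
  "unit_cube d = PiM {1..d} (\<lambda>_. restrict_space lborel {0..1})"

definition char_e :: "nat \<Rightarrow> (nat \<Rightarrow> int) \<Rightarrow> (nat \<Rightarrow> real) \<Rightarrow> complex" where
  "char_e d h x = cis (2 * pi * (\<Sum>j\<in>{1..d}. real_of_int (h j) * x j))"

definition I_d :: "nat \<Rightarrow> ((nat \<Rightarrow> real) \<Rightarrow> complex) \<Rightarrow> complex" where
  "I_d d f = integral\<^sup>L (unit_cube d) f"

definition fourier_coeff :: "nat \<Rightarrow> ((nat \<Rightarrow> real) \<Rightarrow> complex) \<Rightarrow> (nat \<Rightarrow> int) \<Rightarrow> complex" where
  "fourier_coeff d f h = (\<integral>x. f x * cnj (char_e d h x) \<partial>unit_cube d)"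

definition korobov_norm :: "nat \<Rightarrow> real \<Rightarrow> (nat set \<Rightarrow> real) \<Rightarrow> ((nat \<Rightarrow> real) \<Rightarrow> complex) \<Rightarrow> real" where
  "korobov_norm d \<alpha> \<gamma> f =
     sqrt (\<Sum>\<^sub>\<infinity>h\<in>Zd d. (r_weight d \<alpha> \<gamma> h)^2 * (cmod (fourier_coeff d f h))^2)"

definition in_korobov :: "nat \<Rightarrow> real \<Rightarrow> (nat set \<Rightarrow> real) \<Rightarrow> ((nat \<Rightarrow> real) \<Rightarrow> complex) \<Rightarrow> bool" where
  "in_korobov d \<alpha> \<gamma> f \<longleftrightarrow>
     (\<lambda>h. cmod (fourier_coeff d f h)) summable_on Zd d \<and>
     (\<forall>x\<in>space (unit_cube d). f x = (\<Sum>\<^sub>\<infinity>h\<in>Zd d. fourier_coeff d f h * char_e d h x)) \<and>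
     (\<lambda>h. (r_weight d \<alpha> \<gamma> h)^2 * (cmod (fourier_coeff d f h))^2) summable_on Zd d"

definition V_d :: "nat \<Rightarrow> real \<Rightarrow> (nat set \<Rightarrow> real) \<Rightarrow> real" where
  "V_d d s \<gamma> = (\<Sum>u\<in>{u. u \<subseteq> {1..d} \<and> u \<noteq> {}}. \<gamma> u * (2 * zeta_real s) ^ card u)"

definition lattice_rule :: "nat \<Rightarrow> nat \<Rightarrow> (nat \<Rightarrow> nat) \<Rightarrow> ((nat \<Rightarrow> real) \<Rightarrow> complex) \<Rightarrow> complex" where
  "lattice_rule d p z f =
     (\<Sum>k<p. f (\<lambda>j\<in>{1..d}. frac (real k * real (z j) / real p))) / of_nat p"

definition median_real :: "real list \<Rightarrow> real" where
  "median_real xs = sort xs ! (length xs div 2)"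

definition median_complex :: "complex list \<Rightarrow> complex" where
  "median_complex xs = Complex (median_real (map Re xs)) (median_real (map Im xs))"

definition primes_P :: "nat \<Rightarrow> nat set" where
  "primes_P n = {p. prime p \<and> nat \<lceil>real n / 2\<rceil> + 1 \<le> p \<and> p \<le> n}"

definition num_reps :: "(nat \<Rightarrow> real) \<Rightarrow> nat \<Rightarrow> nat" where
  "num_reps h n = 2 * nat \<lceil>h n * log 2 (real n)\<rceil> + 1"

definition pair_pmf_n :: "nat \<Rightarrow> nat \<Rightarrow> (nat \<times> (nat \<Rightarrow> nat)) pmf" where
  "pair_pmf_n n d =
     pmf_of_set (primes_P n) \<bind>
       (\<lambda>p. map_pmf (\<lambda>z. (p, z)) (pmf_of_set (PiE {1..d} (\<lambda>_. {1..p-1}))))"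

definition samples_pmf :: "(nat \<Rightarrow> real) \<Rightarrow> nat \<Rightarrow> nat \<Rightarrow> (nat \<Rightarrow> nat \<times> (nat \<Rightarrow> nat)) pmf" where
  "samples_pmf h n d = Pi_pmf {0..<num_reps h n} (0, \<lambda>_. 0) (\<lambda>_. pair_pmf_n n d)"

definition median_alg :: "(nat \<Rightarrow> real) \<Rightarrow> nat \<Rightarrow> nat \<Rightarrow> (nat \<Rightarrow> nat \<times> (nat \<Rightarrow> nat))
    \<Rightarrow> ((nat \<Rightarrow> real) \<Rightarrow> complex) \<Rightarrow> complex" where
  "median_alg h n d \<omega> f =
     median_complex (map (\<lambda>k. lattice_rule d (fst (\<omega> k)) (snd (\<omega> k)) f) [0..<num_reps h n])"

end

theory Submission
  imports Defs "HOL-Number_Theory.Prime_Powers"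
begin

text \<open>
  Write \<open>V\<close> for \<open>V\<^sub>d(\<alpha>/\<lambda>, \<gamma>\<^bsup>1/\<lambda>\<^esup>)\<close>; it equals the sum of \<open>r(h)\<^bsup>-1/\<lambda>\<^esup>\<close> over all \<open>h \<noteq> 0\<close>.
  The error of a lattice rule is the sum of the Fourier coefficients over the nonzero dual lattice.
  A frequency \<open>h\<close> is dual with probability at most \<open>2/n\<close> plus the proportion of primes in
  \<open>\<P>\<^sub>n\<close> dividing \<open>h\<close>; by Chebyshev's bound for primes in dyadic intervals the latter
  is \<open>O(log |h| / n)\<close>. Call a lattice bad if its dual contains some \<open>h \<noteq> 0\<close> with
  \<open>r(h) \<le> t = (n / (128 V))\<^bsup>\<lambda>\<^esup>\<close>. There are at most \<open>n / 128\<close> such \<open>h\<close>, all too small to be divisible by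
  a prime in \<open>\<P>\<^sub>n\<close>, so a lattice is bad with probability at most \<open>1/64\<close>. On good lattices only
  frequencies with \<open>r(h) > t\<close> contribute, and Cauchy-Schwarz bounds the mean error there by
  \<open>V\<^bsup>\<lambda>\<^esup> n\<^bsup>-\<lambda>-1/2+\<delta>\<^esup>\<close>. The median inherits this bound unless about a quarter of the samples are bad,
  which has probability at most \<open>2\<^bsup>-K\<^esup> \<le> n\<^bsup>-\<lambda>-1/2\<^esup>\<close>, and in that case the error is still at most
  \<open>V\<^bsup>\<lambda>\<^esup> \<parallel>f\<parallel>\<close>.
\<close>

section \<open>Primes in dyadic intervals\<close>

definition chebyshev_psi :: "nat \<Rightarrow> real" where
  "chebyshev_psi n = (\<Sum>d\<in>{1..n}. mangoldt d)"

text \<open>Passing from \<open>n\<close> to \<open>Suc n\<close> raises \<open>n div d\<close> by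
  one exactly when \<open>d\<close> divides \<open>Suc n\<close>, and \<open>mangoldt\<close> summed
  over these divisors is \<open>ln (Suc n)\<close>. The free range bound \<open>N\<close> lets the
  three factorials of a binomial coefficient share one index set.\<close>

lemma ln_fact_eq_sum_mangoldt:
  assumes "n \<le> N"
  shows "ln (fact n) = (\<Sum>d\<in>{1..N}. mangoldt d * real (n div d))"
  using assms
proof (induction n)
  case 0
  then show ?case by simp
next
  case (Suc n)
  have step: "Suc n div d = n div d + (if d dvd Suc n then 1 else 0)" for d
    by (auto simp: div_Suc dvd_eq_mod_eq_0)
  have "ln (fact (Suc n)) = ln (real (Suc n)) + ln (fact n :: real)"
    by (simp add: ln_mult del: of_nat_Suc)
  also have "ln (real (Suc n)) = (\<Sum>d | d dvd Suc n. mangoldt d)"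
    using mangoldt_sum[of "Suc n", where ?'a=real] by simp
  also have "\<dots> = (\<Sum>d\<in>{1..N}. if d dvd Suc n then mangoldt d else 0)"
  proof (subst sum.inter_filter[symmetric], simp, rule sum.cong)
    show "{d. d dvd Suc n} = {x \<in> {1..N}. x dvd Suc n}"
      using Suc.prems by (auto dest: dvd_imp_le intro!: Suc_leI Nat.gr0I)
  qed simp
  also have "ln (fact n :: real) = (\<Sum>d\<in>{1..N}. mangoldt d * real (n div d))"
    using Suc by simp
  also have "(\<Sum>d\<in>{1..N}. if d dvd Suc n then mangoldt d else 0) + \<dots>
      = (\<Sum>d\<in>{1..N}. mangoldt d * real (Suc n div d))"
    unfolding sum.distrib[symmetric] step by (intro sum.cong) (auto simp: algebra_simps)
  finally show ?case .
qed

lemma ln_binomial_eq_sum_mangoldt: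
  "ln (real ((a + b) choose a)) =
     (\<Sum>d\<in>{1..a+b}. mangoldt d * (real ((a + b) div d) - real (a div d) - real (b div d)))"
proof -
  have "real ((a + b) choose a) = fact (a + b) / (fact a * fact b)"
    by (simp add: binomial_fact)
  then have "ln (real ((a + b) choose a)) = ln (fact (a + b)) - ln (fact a) - ln (fact b :: real)"
    by (simp add: ln_div ln_mult)
  also have "\<dots> = (\<Sum>d\<in>{1..a+b}. mangoldt d * real ((a + b) div d))
      - (\<Sum>d\<in>{1..a+b}. mangoldt d * real (a div d)) - (\<Sum>d\<in>{1..a+b}. mangoldt d * real (b div d))"
    using ln_fact_eq_sum_mangoldt[of "a + b" "a + b"] ln_fact_eq_sum_mangoldt[of a "a + b"]
      ln_fact_eq_sum_mangoldt[of b "a + b"] by simp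
  finally show ?thesis
    by (simp add: sum_subtractf[symmetric] algebra_simps)
qed

lemma div_add_div_le: "(a::nat) div d + b div d \<le> (a + b) div d"
  by (subst div_add1_eq) (rule le_add1)

lemma chebyshev_psi_diff:
  assumes "m \<le> n"
  shows "chebyshev_psi n = chebyshev_psi m + (\<Sum>d\<in>{m<..n}. mangoldt d)"
proof -
  have "{1..n} = {1..m} \<union> {m<..n}" using assms by auto
  then show ?thesis
    unfolding chebyshev_psi_def by (simp only:) (rule sum.union_disjoint, auto)
qed

text \<open>In the expansion of the logarithm all coefficients are nonnegative by superadditivity of
  \<open>div\<close>; for b < d \<le> a + b they are at least 1, since \<open>a div d\<close> and
  \<open>b div d\<close> vanish.\<close>

lemma chebyshev_psi_diff_le_ln_binomial:
  assumes "a \<le> b"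
  shows "(\<Sum>d\<in>{b<..a+b}. mangoldt d) \<le> ln (real ((a + b) choose a))"
proof -
  have "(\<Sum>d\<in>{b<..a+b}. mangoldt d)
      \<le> (\<Sum>d\<in>{b<..a+b}. mangoldt d * (real ((a + b) div d) - real (a div d) - real (b div d)))"
  proof (rule sum_mono)
    fix d assume d: "d \<in> {b<..a+b}"
    then have "(a + b) div d \<ge> 1" "a div d = 0" "b div d = 0"
      using assms by (auto simp: Suc_leI div_greater_zero_iff)
    then show "mangoldt d \<le> mangoldt d * (real ((a + b) div d) - real (a div d) - real (b div d))"
      using mult_left_mono[of 1 "real ((a + b) div d)", OF _ mangoldt_nonneg[of d]] by simp
  qed
  also have "\<dots> \<le> (\<Sum>d\<in>{1..a+b}. mangoldt d * (real ((a + b) div d) - real (a div d) - real (b div d)))"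
  proof (rule sum_mono2)
    fix d
    have "real (a div d) + real (b div d) \<le> real ((a + b) div d)"
      using div_add_div_le[of a d b] by (simp flip: of_nat_add)
    then show "0 \<le> mangoldt d * (real ((a + b) div d) - real (a div d) - real (b div d))"
      by (intro mult_nonneg_nonneg mangoldt_nonneg) simp
  qed auto
  finally show ?thesis by (simp add: ln_binomial_eq_sum_mangoldt)
qed

lemma binomial_half_le: "n choose (n div 2) \<le> 4 ^ (n div 2)"
proof (cases "even n")
  case True
  then obtain a where "n = 2 * a" by auto
  then show ?thesis using binomial_le_pow2[of n a] by (simp add: power_mult)
next
  case False
  then obtain a where a: "n = 2 * a + 1" by (auto elim: oddE)
  \<comment> \<open>For odd \<open>n\<close> the two middle coefficients coincide, so each is at
    most half of 2^n.\<close>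
  have "(n choose a) + (n choose Suc a) = (\<Sum>k\<in>{a, Suc a}. n choose k)"
    by simp
  also have "\<dots> \<le> (\<Sum>k\<le>n. n choose k)"
    using a by (intro sum_mono2) auto
  also have "\<dots> = 2 * 4 ^ a"
    unfolding choose_row_sum using a by (simp add: power_mult)
  finally show ?thesis
    using a binomial_symmetric[of a n] by simp
qed

text \<open>Strong induction by halving: the integers above \<open>n - n div 2\<close> contribute at
  most \<open>ln (n choose (n div 2))\<close>, hence at most \<open>(n div 2) * ln 4\<close>, and
  the induction hypothesis covers the rest.\<close>

lemma chebyshev_psi_le: "chebyshev_psi n \<le> real n * ln 4"
proof (induction n rule: less_induct)
  case (less n)
  show ?case
  proof (cases "n \<le> 1")
    case True
    then have "n = 0 \<or> n = 1" by auto
    then show ?thesis by (auto simp: chebyshev_psi_def)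
  next
    case False
    define a where "a = n div 2"
    define b where "b = n - a"
    have ab: "a \<le> b" "b < n" "n = a + b" using False by (auto simp: a_def b_def)
    have "real (n choose a) \<le> 4 ^ a"
      using binomial_half_le[of n] unfolding a_def[symmetric]
      by (metis of_nat_le_iff of_nat_numeral of_nat_power)
    then have "ln (real (n choose a)) \<le> ln (4 ^ a)"
      using ab by (subst ln_le_cancel_iff) (auto simp: zero_less_binomial)
    then have "ln (real (n choose a)) \<le> real a * ln 4"
      by (simp add: ln_realpow)
    moreover have "chebyshev_psi n \<le> chebyshev_psi b + ln (real (n choose a))"
      using chebyshev_psi_diff[of b n] chebyshev_psi_diff_le_ln_binomial[of a b] ab by simp
    moreover have "chebyshev_psi b \<le> real b * ln 4"
      using less.IH ab by simp
    ultimately show ?thesis using ab by (simp add: algebra_simps)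
  qed
qed

section \<open>Chebyshev's lower bound for the primes between m and 2m\<close>

text \<open>As in Erdos's proof of Bertrand's postulate: the coefficient
  \<open>2 * m div d - 2 * (m div d)\<close> never exceeds 1, and it vanishes for 2m/3 < d \<le> m,
  where the quotients are 2 and 1.\<close>

lemma ln_central_binomial_le:
  "ln (real ((2 * m) choose m)) \<le> chebyshev_psi (2 * m div 3) + (\<Sum>d\<in>{m<..2*m}. mangoldt d)"
proof -
  have "ln (real ((2 * m) choose m)) =
      (\<Sum>d\<in>{1..2*m}. mangoldt d * (real (2 * m div d) - 2 * real (m div d)))"
    using ln_binomial_eq_sum_mangoldt[of m m] by (simp only: mult_2 diff_diff_eq)
  also have "\<dots> \<le> (\<Sum>d\<in>{1..2*m}. if d \<in> {1..2 * m div 3} \<union> {m<..2*m} then mangoldt d else 0)"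
  proof (rule sum_mono)
    fix d assume d: "d \<in> {1..2*m}"
    have "2 * m div d < 2 * (m div d) + 2"
    proof (subst div_less_iff_less_mult)
      have "m < (m div d + 1) * d"
        using d dividend_less_div_times[of d m] by (simp add: algebra_simps)
      then show "2 * m < (2 * (m div d) + 2) * d" by (simp add: algebra_simps)
    qed (use d in auto)
    then have "real (2 * m div d) - 2 * real (m div d) \<le> 1"
      by linarith
    then have 1: "mangoldt d * (real (2 * m div d) - 2 * real (m div d)) \<le> mangoldt d"
      using mult_left_mono[of _ 1, OF _ mangoldt_nonneg[of d]] by simp
    show "mangoldt d * (real (2 * m div d) - 2 * real (m div d))
        \<le> (if d \<in> {1..2 * m div 3} \<union> {m<..2*m} then mangoldt d else 0)"
    proof (cases "d \<in> {1..2 * m div 3} \<union> {m<..2*m}")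
      case True
      then show ?thesis using 1 by simp
    next
      case False
      then have "d \<le> m" "2 * m < 3 * d" using d by auto
      then have "m div d = 1" "2 * m div d = 2" by (auto intro!: div_nat_eqI)
      then have "mangoldt d * (real (2 * m div d) - 2 * real (m div d)) = 0" by simp
      then show ?thesis by (simp only: if_not_P[OF False] order_refl)
    qed
  qed
  also have "\<dots> = (\<Sum>d\<in>{1..2 * m div 3} \<union> {m<..2*m}. mangoldt d)"
  proof -
    have "{1..2*m} \<inter> ({1..2 * m div 3} \<union> {m<..2*m}) = {1..2 * m div 3} \<union> {m<..2*m}" by auto
    then show ?thesis by (simp only: sum.inter_restrict[symmetric, OF finite_atLeastAtMost])
  qed
  also have "\<dots> \<le> (\<Sum>d\<in>{1..2 * m div 3}. mangoldt d) + (\<Sum>d\<in>{m<..2*m}. mangoldt d)"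
    by (subst sum.union_disjoint) auto
  finally show ?thesis by (simp add: chebyshev_psi_def)
qed

text \<open>A prime contributes at most \<open>ln (2 * m)\<close>. A proper prime power contributes
  \<open>ln p\<close> with p^2 \<le> 2m, at most half of that, and there are at most sqrt(2m) of
  them because each belongs to a different prime.\<close>

lemma sum_mangoldt_dyadic_le:
  assumes "m \<ge> 1"
  shows "(\<Sum>d\<in>{m<..2*m}. mangoldt d)
    \<le> real (card {p \<in> {m<..2*m}. prime p}) * ln (2 * real m) + sqrt (2 * real m) * (ln (2 * real m) / 2)"
proof -
  let ?P = "{p \<in> {m<..2*m}. prime p}" and ?Q = "{q \<in> {m<..2*m}. primepow q \<and> \<not> prime q}"
  have "(\<Sum>d\<in>{m<..2*m}. mangoldt d :: real) = (\<Sum>d\<in>?P \<union> ?Q. mangoldt d)"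
    by (rule sum.mono_neutral_right) (auto simp: mangoldt_def)
  also have "\<dots> = (\<Sum>d\<in>?P. mangoldt d) + (\<Sum>d\<in>?Q. mangoldt d)"
    by (rule sum.union_disjoint) auto
  also have "(\<Sum>d\<in>?P. mangoldt d) \<le> real (card ?P) * ln (2 * real m)"
  proof (rule sum_bounded_above)
    fix p assume p: "p \<in> ?P"
    then have "real p \<le> 2 * real m" "p > 0" by (auto simp: prime_gt_0_nat)
    then show "mangoldt p \<le> ln (2 * real m)" using p by simp
  qed
  also have "(\<Sum>d\<in>?Q. mangoldt d) \<le> sqrt (2 * real m) * (ln (2 * real m) / 2)"
  proof -
    have Q: "\<exists>p k. prime p \<and> k \<ge> 2 \<and> q = p ^ k \<and> aprimedivisor q = p \<and> p\<^sup>2 \<le> q" if q: "q \<in> ?Q" for q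
    proof -
      obtain p k where pk: "prime p" "k > 0" "q = p ^ k" using q by (auto simp: primepow_def)
      then have "k \<noteq> 1" using q by auto
      then have k: "k \<ge> 2" using pk by simp
      have "p\<^sup>2 \<le> q"
        unfolding pk(3) by (rule power_increasing[OF k]) (use prime_gt_0_nat[OF pk(1)] in simp)
      then show ?thesis using pk k aprimedivisor_prime_power by blast
    qed
    \<comment> \<open>Distinct powers of one prime differ by a factor of at least 2, so they cannot
      both lie in (m, 2m].\<close>
    have inj: "inj_on aprimedivisor ?Q"
    proof -
      have less: False if q: "q \<in> ?Q" "q' \<in> ?Q" "aprimedivisor q = aprimedivisor q'" "q < q'" for q q'
      proof -
        obtain p k where pk: "prime p" "q = p ^ k" "aprimedivisor q = p" using Q[OF q(1)] by blast
        obtain k' where pk': "q' = p ^ k'" using Q[OF q(2)] q(3) pk(3) by metis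
        have "p ^ k < p ^ k'" using q(4) pk(2) pk' by simp
        then have "k < k'" using power_less_imp_less_exp[OF prime_gt_1_nat[OF pk(1)]] by blast
        then have "p ^ Suc k \<le> q'"
          unfolding pk' using prime_ge_1_nat[OF pk(1)] by (intro power_increasing Suc_leI)
        moreover have "p ^ Suc k \<ge> 2 * q"
          unfolding pk(2) power_Suc using prime_ge_2_nat[OF pk(1)] by (rule mult_right_mono) simp
        ultimately show False using q by auto
      qed
      show ?thesis
      proof (rule inj_onI)
        fix q q' assume q: "q \<in> ?Q" "q' \<in> ?Q" "aprimedivisor q = aprimedivisor q'"
        show "q = q'"
          using less[OF q] less[OF q(2,1) q(3)[symmetric]] by (cases q q' rule: linorder_cases) simp_all
      qed
    qed
    have img: "aprimedivisor ` ?Q \<subseteq> {1..nat \<lfloor>sqrt (2 * real m)\<rfloor>}"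
    proof (rule image_subsetI)
      fix q assume q: "q \<in> ?Q"
      obtain p where p: "prime p" "aprimedivisor q = p" "p\<^sup>2 \<le> q" using Q[OF q] by blast
      then have "p\<^sup>2 \<le> 2 * m" using q by auto
      then have "real p ^ 2 \<le> 2 * real m"
        by (metis of_nat_le_iff of_nat_mult of_nat_numeral of_nat_power)
      then have "real p \<le> sqrt (2 * real m)" by (rule real_le_rsqrt)
      then show "aprimedivisor q \<in> {1..nat \<lfloor>sqrt (2 * real m)\<rfloor>}"
        unfolding p(2) using prime_ge_1_nat[OF p(1)] by (simp add: le_nat_floor)
    qed
    have "card ?Q \<le> nat \<lfloor>sqrt (2 * real m)\<rfloor>"
      using card_inj_on_le[OF inj img] by simp
    then have "real (card ?Q) \<le> real (nat \<lfloor>sqrt (2 * real m)\<rfloor>)"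
      by (rule of_nat_mono)
    also have "\<dots> \<le> sqrt (2 * real m)"
      by (rule of_nat_floor) simp
    finally have card: "real (card ?Q) \<le> sqrt (2 * real m)" .
    have "(\<Sum>d\<in>?Q. mangoldt d) \<le> real (card ?Q) * (ln (2 * real m) / 2)"
    proof (rule sum_bounded_above)
      fix q assume q: "q \<in> ?Q"
      obtain p k where p: "prime p" "k \<ge> 2" "q = p ^ k" "p\<^sup>2 \<le> q" using Q[OF q] by blast
      then have "p\<^sup>2 \<le> 2 * m" using q by auto
      then have "real p ^ 2 \<le> 2 * real m"
        by (metis of_nat_le_iff of_nat_mult of_nat_numeral of_nat_power)
      then have "ln (real p ^ 2) \<le> ln (2 * real m)"
        using prime_gt_0_nat[OF p(1)] by (subst ln_le_cancel_iff) (use assms in auto)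
      then have "2 * ln (real p) \<le> ln (2 * real m)"
        using prime_gt_0_nat[OF p(1)] by (simp add: ln_realpow)
      then show "mangoldt q \<le> ln (2 * real m) / 2" using p by simp
    qed
    also have "\<dots> \<le> sqrt (2 * real m) * (ln (2 * real m) / 2)"
      using assms by (intro mult_right_mono card) auto
    finally show ?thesis .
  qed
  finally show ?thesis by simp
qed

text \<open>The central binomial coefficient is at least 4^m/(2m). Of its logarithm the range up to
  2m/3 absorbs at most two thirds of m ln 4, by the upper bound for \<open>chebyshev_psi\<close>;
  the last third is left for the prime powers above m.\<close>

lemma prime_count_dyadic_aux:
  assumes "m \<ge> 1"
  shows "real m / 3 * ln 4 - ln (2 * real m) - sqrt (2 * real m) * (ln (2 * real m) / 2)
     \<le> real (card {p \<in> {m<..2*m}. prime p}) * ln (2 * real m)"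
proof -
  have "ln (4 ^ m / (2 * real m)) \<le> ln (real ((2*m) choose m))"
    using assms central_binomial_lower_bound[of m] by (subst ln_le_cancel_iff) auto
  then have "real m * ln 4 - ln (2 * real m) \<le> ln (real ((2*m) choose m))"
    using assms by (simp add: ln_div ln_realpow)
  also note ln_central_binomial_le
  also have "chebyshev_psi (2 * m div 3) \<le> (2 * real m / 3) * ln 4"
  proof -
    have "chebyshev_psi (2 * m div 3) \<le> real (2 * m div 3) * ln 4" by (rule chebyshev_psi_le)
    also have "real (2 * m div 3) \<le> 2 * real m / 3"
      by linarith
    finally show ?thesis by (simp add: mult_right_mono)
  qed
  also note sum_mangoldt_dyadic_le[OF assms]
  finally show ?thesis by (simp add: algebra_simps)
qed

text \<open>In the chain 2, 3, 5, 7, 13, 23, 43, 83, 163, 317 each prime is less than twice its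
  predecessor, so it serves every \<open>m\<close> from the predecessor up to itself.\<close>

lemma exists_prime_dyadic_small:
  assumes "1 \<le> m" "m < 317"
  shows "\<exists>p\<in>{m<..2*m}. prime (p::nat)"
proof -
  consider "m < 2" | "2 \<le> m" "m < 3" | "3 \<le> m" "m < 5" | "5 \<le> m" "m < 7"
    | "7 \<le> m" "m < 13" | "13 \<le> m" "m < 23" | "23 \<le> m" "m < 43" | "43 \<le> m" "m < 83"
    | "83 \<le> m" "m < 163" | "163 \<le> m" "m < 317"
    using assms by linarith
  then show ?thesis
  proof cases
    case 1
    then show ?thesis using assms by (intro bexI[of _ 2]) auto
  next
    case 2
    then show ?thesis using assms by (intro bexI[of _ 3]) auto
  next
    case 3
    then show ?thesis using assms by (intro bexI[of _ 5]) auto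
  next
    case 4
    then show ?thesis using assms by (intro bexI[of _ 7]) auto
  next
    case 5
    then show ?thesis using assms by (intro bexI[of _ 13]) auto
  next
    case 6
    then show ?thesis using assms by (intro bexI[of _ 23]) auto
  next
    case 7
    then show ?thesis using assms by (intro bexI[of _ 43]) auto
  next
    case 8
    then show ?thesis using assms by (intro bexI[of _ 83]) auto
  next
    case 9
    then show ?thesis using assms by (intro bexI[of _ 163]) auto
  next
    case 10
    then show ?thesis using assms by (intro bexI[of _ 317]) auto
  qed
qed

lemma ln_four_gt: "ln (4::real) \<ge> 6 / 5"
proof -
  have "exp (6/5 :: real) = exp (1/5) ^ 6" by (simp flip: exp_of_nat_mult)
  also have "\<dots> \<le> (1 + 1/5 + (1/5)\<^sup>2) ^ 6"
    by (intro power_mono exp_bound) auto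
  also have "\<dots> \<le> 4" by (simp add: field_simps power2_eq_square eval_nat_numeral)
  finally show ?thesis by (subst ln_ge_iff) auto
qed

text \<open>With y the fourth root of 2m, the logarithmic error terms are bounded by a cubic in y,
  which is at most 7m/20 once y \<ge> 5, that is 2m \<ge> 625. The main term is at least 2m/5, which
  leaves m/20.\<close>

lemma prime_count_dyadic_large:
  assumes "m \<ge> 317"
  shows "real m / 20 \<le> real (card {p \<in> {m<..2*m}. prime p}) * ln (2 * real m)"
proof -
  define y where "y = sqrt (sqrt (2 * real m))"
  have y4: "y ^ 4 = 2 * real m" and y2: "y ^ 2 = sqrt (2 * real m)"
    using power_mult[of y 2 2] by (simp_all add: y_def)
  have y: "y \<ge> 5"
    unfolding y_def using assms by (intro real_le_rsqrt) (auto simp: power2_eq_square intro!: real_le_rsqrt)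
  \<comment> \<open>This gives exp(13/8) \<ge> 5; the tangent of the logarithm at 5 then bounds
    \<open>ln y\<close> linearly.\<close>
  have "(5::real) \<le> (1 + 1/8 + (1/8)\<^sup>2 / 2) ^ 13"
    by (simp add: field_simps power2_eq_square eval_nat_numeral)
  also have "\<dots> \<le> exp (1/8) ^ 13"
    by (intro power_mono exp_lower_Taylor_quadratic) auto
  also have "\<dots> = exp (13/8)" by (simp flip: exp_of_nat_mult)
  finally have ln5: "ln 5 \<le> (13/8 :: real)" by (metis exp_gt_zero ln_exp ln_le_cancel_iff zero_less_numeral)
  have "ln y = ln 5 + ln (y / 5)" using y by (simp add: ln_div)
  also have "\<dots> \<le> 13/8 + (y / 5 - 1)" using ln5 ln_le_minus_one[of "y / 5"] y by linarith
  finally have lny: "ln y \<le> y / 5 + 5/8" by simp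
  have ln2m: "ln (2 * real m) = 4 * ln y"
    unfolding y4[symmetric] using y by (simp add: ln_realpow)
  have "ln (2 * real m) + sqrt (2 * real m) * (ln (2 * real m) / 2) = 4 * ln y * (1 + y\<^sup>2 / 2)"
    unfolding ln2m y2[symmetric] by (simp add: algebra_simps)
  also have "\<dots> \<le> 4 * (y / 5 + 5/8) * (1 + y\<^sup>2 / 2)"
    using lny by (intro mult_right_mono) auto
  also have "\<dots> = 2/5 * y ^ 3 + 5/4 * y\<^sup>2 + 4/5 * y + 5/2"
    by (simp add: field_simps power2_eq_square power3_eq_cube)
  also have "\<dots> \<le> 7/40 * y ^ 4"
  proof -
    have "5 * y \<le> y\<^sup>2" using mult_right_mono[OF y, of y] y by (simp add: power2_eq_square)
    moreover have "5 * y\<^sup>2 \<le> y ^ 3"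
      using mult_right_mono[OF y, of "y\<^sup>2"] by (simp add: eval_nat_numeral)
    moreover have "5 * y ^ 3 \<le> y ^ 4"
      using mult_right_mono[OF y, of "y ^ 3"] y by (simp add: eval_nat_numeral)
    ultimately show ?thesis using y by linarith
  qed
  also have "\<dots> = 7/20 * real m" by (simp add: y4)
  finally have "ln (2 * real m) + sqrt (2 * real m) * (ln (2 * real m) / 2) \<le> 7/20 * real m" .
  moreover have "real m / 3 * ln 4 \<ge> 2/5 * real m"
    using mult_left_mono[OF ln_four_gt, of "real m / 3"] by simp
  ultimately show ?thesis
    using prime_count_dyadic_aux[of m] assms by linarith
qed

text \<open>The generous constant 2000 makes a single prime suffice for m < 317.\<close>

lemma prime_count_dyadic:
  assumes "m \<ge> 1"
  shows "real m / 2000 \<le> real (card {p \<in> {m<..2*m}. prime p}) * ln (2 * real m)"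
proof (cases "m < 317")
  case True
  obtain p where p: "p \<in> {m<..2*m}" "prime p"
    using exists_prime_dyadic_small[OF assms True] by blast
  then have "card {p \<in> {m<..2*m}. prime p} \<noteq> 0"
    by (subst card_0_eq) auto
  then have "1 \<le> real (card {p \<in> {m<..2*m}. prime p})" by linarith
  then have "1 * ln 2 \<le> real (card {p \<in> {m<..2*m}. prime p}) * ln (2 * real m)"
    using assms by (intro mult_mono) simp_all
  moreover have "real m / 2000 \<le> ln 2"
    using True ln_four_gt ln_realpow[of 2 2] by simp
  ultimately show ?thesis by linarith
qed (use prime_count_dyadic_large[of m] in linarith)

text \<open>Only odd \<open>n\<close> needs an argument: there \<open>2 * m = n + 1\<close> is even
  and larger than 2, so the extra endpoint is not prime.\<close>

lemma primes_P_eq_dyadic: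
  assumes "n \<ge> 2" and "m = nat \<lceil>real n / 2\<rceil>"
  shows "primes_P n = {p \<in> {m<..2*m}. prime p}"
proof -
  have m: "m = (n + 1) div 2"
    unfolding assms(2) by linarith
  have "p \<le> n" if p: "prime p" "p \<le> 2 * m" for p
  proof (rule ccontr)
    assume "\<not> p \<le> n"
    then have "p = n + 1" "odd n" using p(2) m by (auto elim: evenE)
    then have "p = 2" using p(1) prime_odd_nat[of p] \<open>n \<ge> 2\<close> by auto
    then show False using \<open>p = n + 1\<close> assms(1) by simp
  qed
  moreover have "p \<le> 2 * m" if "p \<le> n" for p using that m by linarith
  ultimately show ?thesis
    by (auto simp: primes_P_def assms(2)[symmetric])
qed

text \<open>Two factors of 2 turn 2000 into 8000: m \<ge> n/2, and \<open>ln (2 * m)\<close> is at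
  most \<open>2 * ln n\<close>.\<close>

lemma card_primes_P_ge:
  assumes "n \<ge> 2"
  shows "real n / 8000 \<le> real (card (primes_P n)) * ln (real n)"
proof -
  define m where "m = nat \<lceil>real n / 2\<rceil>"
  have m: "2 * m \<le> n + 1" "n \<le> 2 * m" "m \<ge> 1"
    unfolding m_def using assms by linarith+
  have "ln (2 * real m) \<le> ln (real n ^ 2)"
  proof (subst ln_le_cancel_iff)
    have "2 * real m \<le> 2 * real n" using m by linarith
    also have "\<dots> \<le> real n ^ 2" using assms by (simp add: power2_eq_square)
    finally show "2 * real m \<le> real n ^ 2" .
  qed (use m assms in auto)
  then have "ln (2 * real m) \<le> 2 * ln (real n)" using assms by (simp add: ln_realpow)
  then have "real (card (primes_P n)) * ln (2 * real m) \<le> real (card (primes_P n)) * (2 * ln (real n))"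
    by (intro mult_left_mono) auto
  moreover have "real m / 2000 \<le> real (card (primes_P n)) * ln (2 * real m)"
    using prime_count_dyadic[of m] m primes_P_eq_dyadic[OF assms m_def] by simp
  ultimately show ?thesis using m by linarith
qed

lemma finite_primes_P: "finite (primes_P n)"
  by (rule finite_subset[of _ "{..n}"]) (auto simp: primes_P_def)

lemma primes_P_nonempty:
  assumes "n \<ge> 2"
  shows "primes_P n \<noteq> {}"
  using card_primes_P_ge[OF assms] assms by auto

section \<open>Medians of independent samples\<close>

lemma card_filter_sort:
  "card {k. k < length xs \<and> P (xs ! k)} = card {k. k < length xs \<and> P (sort xs ! k)}"
proof -
  have "length (filter P (sort xs)) = length (filter P xs)"
    by (metis mset_filter mset_sort size_mset)
  then show ?thesis
    by (simp add: length_filter_conv_card)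
qed

text \<open>The median has index \<open>K\<close> in sorted order. If it is at least
  \<open>a\<close>, it and the \<open>K\<close> entries after it are at least as far from
  \<open>a\<close>; otherwise it and the \<open>K\<close> entries before it are.\<close>

lemma card_deviation_ge_median_deviation:
  assumes len: "length xs = 2 * K + 1"
  shows "K + 1 \<le> card {k. k < length xs \<and> \<bar>median_real xs - a\<bar> \<le> \<bar>xs ! k - a\<bar>}"
proof -
  define m where "m = median_real xs"
  have m: "m = sort xs ! K" using len by (simp add: m_def median_real_def)
  have mono: "sort xs ! i \<le> sort xs ! j" if "i \<le> j" "j < length xs" for i j
    using sorted_nth_mono[of "sort xs" i j] that by simp
  obtain S where S: "card S = K + 1" "S \<subseteq> {k. k < length xs \<and> \<bar>m - a\<bar> \<le> \<bar>sort xs ! k - a\<bar>}"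
  proof (cases "a \<le> m")
    case True
    have "\<bar>m - a\<bar> \<le> \<bar>sort xs ! k - a\<bar>" if "k \<in> {K..2*K}" for k
      using mono[of K k] that True len m by simp
    then show thesis using len by (intro that[of "{K..2*K}"]) auto
  next
    case False
    have "\<bar>m - a\<bar> \<le> \<bar>sort xs ! k - a\<bar>" if "k \<in> {..K}" for k
      using mono[of k K] that False len m by simp
    then show thesis using len by (intro that[of "{..K}"]) auto
  qed
  have "card S \<le> card {k. k < length xs \<and> \<bar>m - a\<bar> \<le> \<bar>sort xs ! k - a\<bar>}"
    by (rule card_mono[OF _ S(2)]) simp
  then show ?thesis
    unfolding m_def[symmetric] using S(1) card_filter_sort[of xs "\<lambda>x. \<bar>m - a\<bar> \<le> \<bar>x - a\<bar>"] by simp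
qed

text \<open>If fewer than half of the \<open>K + 1\<close> samples deviating at least as much as the median are bad,
  the good ones among them pay for the median by averaging; otherwise \<open>64 ^ #bad \<ge> 8 ^ (K + 1)\<close>.\<close>

lemma median_deviation_le:
  fixes e :: "nat \<Rightarrow> real"
  assumes len: "length xs = 2 * K + 1"
    and e: "\<And>k. k < 2 * K + 1 \<Longrightarrow> \<bar>xs ! k - a\<bar> \<le> e k"
    and E: "\<And>k. k < 2 * K + 1 \<Longrightarrow> e k \<le> E"
  shows "\<bar>median_real xs - a\<bar> \<le>
     2 / real (K + 1) * (\<Sum>k\<in>{0..<2*K+1}. if bad k then 0 else e k)
     + E * ((\<Prod>k\<in>{0..<2*K+1}. if bad k then 64 else 1) / 8 ^ (K + 1))"
proof -
  define m where "m = \<bar>median_real xs - a\<bar>"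
  define D where "D = {k. k < 2 * K + 1 \<and> m \<le> \<bar>xs ! k - a\<bar>}"
  define B where "B = {k \<in> {0..<2*K+1}. bad k}"
  have fin: "finite D" "finite B" by (simp_all add: D_def B_def)
  have D: "K + 1 \<le> card D"
    using card_deviation_ge_median_deviation[OF len, of a] by (simp add: D_def m_def len)
  have e0: "0 \<le> e k" if "k < 2 * K + 1" for k using e[OF that] by linarith
  have E0: "0 \<le> E" using e0[of 0] E[of 0] by linarith
  have sum0: "0 \<le> (\<Sum>k\<in>{0..<2*K+1}. if bad k then 0 else e k)"
    by (rule sum_nonneg) (auto intro: e0)
  have "(\<Prod>k\<in>S. if bad k then 64 else 1) = (64::real) ^ card {k \<in> S. bad k}" if "finite S" for S
    using that by (simp add: prod.If_cases Int_def)
  then have prod: "(\<Prod>k\<in>{0..<2*K+1}. if bad k then 64 else 1) = (64::real) ^ card B"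
    unfolding B_def by blast
  have m_le_E: "m \<le> E"
  proof -
    have "D \<noteq> {}" using D by auto
    then obtain k where "k \<in> D" by blast
    then show ?thesis using e[of k] E[of k] by (auto simp: D_def)
  qed
  show ?thesis
  proof (cases "K + 1 \<le> 2 * card B")
    case True
    have "(8::real) ^ (K + 1) \<le> 8 ^ (2 * card B)"
      using True by (rule power_increasing) simp
    also have "\<dots> = 64 ^ card B" by (simp add: power_mult)
    finally have "1 \<le> (64::real) ^ card B / 8 ^ (K + 1)" by simp
    then have "E * 1 \<le> E * (64 ^ card B / 8 ^ (K + 1))"
      using E0 by (rule mult_left_mono)
    moreover have "0 \<le> 2 / real (K + 1) * (\<Sum>k\<in>{0..<2*K+1}. if bad k then 0 else e k)"
      using sum0 by simp
    ultimately show ?thesis using m_le_E unfolding prod m_def by linarith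
  next
    case False
    have "card D \<le> card (D - B) + card B"
      by (metis card_Un_le Un_Diff_cancel2 card_mono fin finite_UnI finite_Diff le_trans sup_ge1)
    then have "K + 1 \<le> 2 * card (D - B)" using D False by linarith
    then have "real (K + 1) \<le> real (2 * card (D - B))" by (rule of_nat_mono)
    then have "real (K + 1) / 2 \<le> real (card (D - B))" by simp
    then have "real (K + 1) / 2 * m \<le> real (card (D - B)) * m"
      by (rule mult_right_mono) (simp add: m_def)
    also have "\<dots> = (\<Sum>k\<in>D - B. m)" by simp
    also have "\<dots> \<le> (\<Sum>k\<in>D - B. if bad k then 0 else e k)"
      by (rule sum_mono) (use e in \<open>force simp: D_def B_def\<close>)
    also have "\<dots> \<le> (\<Sum>k\<in>{0..<2*K+1}. if bad k then 0 else e k)"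
      by (rule sum_mono2) (auto simp: D_def intro: e0)
    finally have "m \<le> 2 / real (K + 1) * (\<Sum>k\<in>{0..<2*K+1}. if bad k then 0 else e k)"
      by (simp add: field_simps)
    moreover have "0 \<le> E * (64 ^ card B / 8 ^ (K + 1))" using E0 by simp
    ultimately show ?thesis unfolding prod m_def by linarith
  qed
qed

text \<open>The real estimate applies to both coordinates with the common majorant
  \<open>cmod (a - Q k)\<close>; adding the two doubles both constants.\<close>

lemma median_complex_deviation_le:
  fixes Q :: "nat \<Rightarrow> complex"
  assumes E: "\<And>k. k < 2 * K + 1 \<Longrightarrow> cmod (a - Q k) \<le> E"
  shows "cmod (a - median_complex (map Q [0..<2*K+1])) \<le>
     4 / real (K + 1) * (\<Sum>k\<in>{0..<2*K+1}. if bad k then 0 else cmod (a - Q k))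
     + 2 * E * ((\<Prod>k\<in>{0..<2*K+1}. if bad k then 64 else 1) / 8 ^ (K + 1))"
proof -
  let ?M = "median_complex (map Q [0..<2*K+1])"
  let ?B = "2 / real (K + 1) * (\<Sum>k\<in>{0..<2*K+1}. if bad k then 0 else cmod (a - Q k))
     + E * ((\<Prod>k\<in>{0..<2*K+1}. if bad k then 64 else 1) / 8 ^ (K + 1))"
  have "\<bar>median_real (map Re (map Q [0..<2*K+1])) - Re a\<bar> \<le> ?B"
  proof (rule median_deviation_le)
    fix k assume k: "k < 2 * K + 1"
    then have "map Re (map Q [0..<2*K+1]) ! k = Re (Q k)" by (simp del: upt_Suc)
    then show "\<bar>map Re (map Q [0..<2*K+1]) ! k - Re a\<bar> \<le> cmod (a - Q k)"
      using abs_Re_le_cmod[of "Q k - a"] by (simp add: norm_minus_commute)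
  qed (use E in simp_all)
  moreover have "\<bar>median_real (map Im (map Q [0..<2*K+1])) - Im a\<bar> \<le> ?B"
  proof (rule median_deviation_le)
    fix k assume k: "k < 2 * K + 1"
    then have "map Im (map Q [0..<2*K+1]) ! k = Im (Q k)" by (simp del: upt_Suc)
    then show "\<bar>map Im (map Q [0..<2*K+1]) ! k - Im a\<bar> \<le> cmod (a - Q k)"
      using abs_Im_le_cmod[of "Q k - a"] by (simp add: norm_minus_commute)
  qed (use E in simp_all)
  moreover have "cmod (a - ?M) \<le> \<bar>Re (?M - a)\<bar> + \<bar>Im (?M - a)\<bar>"
    by (subst norm_minus_commute) (rule cmod_le)
  ultimately have "cmod (a - ?M) \<le> ?B + ?B"
    unfolding median_complex_def minus_complex.simps complex.sel by linarith
  then show ?thesis by (simp add: algebra_simps)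
qed

lemma expectation_Pi_pmf_component:
  fixes g :: "'b \<Rightarrow> real"
  assumes "finite A" "x \<in> A"
  shows "measure_pmf.expectation (Pi_pmf A dflt p) (\<lambda>\<omega>. g (\<omega> x)) = measure_pmf.expectation (p x) g"
proof -
  have "measure_pmf.expectation (p x) g = measure_pmf.expectation (map_pmf (\<lambda>\<omega>. \<omega> x) (Pi_pmf A dflt p)) g"
    using Pi_pmf_component[OF assms(1), of x dflt p] assms(2) by simp
  then show ?thesis by simp
qed

lemma finite_set_Pi_pmf:
  assumes "finite A" "\<And>x. x \<in> A \<Longrightarrow> finite (set_pmf (p x))"
  shows "finite (set_pmf (Pi_pmf A dflt p))"
  using assms by (simp add: set_Pi_pmf finite_PiE_dflt)

text \<open>By linearity the good samples cost 4(2K+1)/(K+1) \<le> 8 times their mean. By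
  independence the mean of 64^#bad is a power of a single-sample mean, so no binomial tail has to be
  estimated.\<close>

lemma expectation_median_deviation_le:
  fixes q :: "'a pmf" and Q :: "'a \<Rightarrow> complex"
  assumes fin: "finite (set_pmf q)"
    and E: "\<And>x. x \<in> set_pmf q \<Longrightarrow> cmod (a - Q x) \<le> E"
    and bad: "measure_pmf.prob q {x. bad x} \<le> 1 / 64"
    and T: "measure_pmf.expectation q (\<lambda>x. if bad x then 0 else cmod (a - Q x)) \<le> T"
  shows "measure_pmf.expectation (Pi_pmf {0..<2*K+1} dflt (\<lambda>_. q))
      (\<lambda>\<omega>. cmod (a - median_complex (map (\<lambda>k. Q (\<omega> k)) [0..<2*K+1])))
     \<le> 8 * T + E / 2 ^ K"
proof -
  let ?A = "{0..<2*K+1}"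
  let ?P = "Pi_pmf ?A dflt (\<lambda>_. q)"
  let ?g = "\<lambda>x. if bad x then 0 else cmod (a - Q x)" and ?b = "\<lambda>x. if bad x then 64 else 1 :: real"
  have finP: "finite (set_pmf ?P)"
    using fin by (intro finite_set_Pi_pmf) auto
  have int: "integrable (measure_pmf ?P) f" for f :: "(nat \<Rightarrow> 'a) \<Rightarrow> real"
    by (rule integrable_measure_pmf_finite[OF finP])
  have intq: "integrable (measure_pmf q) f" for f :: "'a \<Rightarrow> real"
    by (rule integrable_measure_pmf_finite[OF fin])
  have E0: "0 \<le> E"
    using set_pmf_not_empty[of q] E by (metis ex_in_conv norm_ge_zero order_trans)
  have T0: "0 \<le> T"
    using T by (rule order_trans[rotated]) (auto intro!: Bochner_Integration.integral_nonneg)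
  have "measure_pmf.expectation ?P (\<lambda>\<omega>. cmod (a - median_complex (map (\<lambda>k. Q (\<omega> k)) [0..<2*K+1])))
    \<le> measure_pmf.expectation ?P (\<lambda>\<omega>. 4 / real (K + 1) * (\<Sum>k\<in>?A. ?g (\<omega> k))
        + 2 * E * ((\<Prod>k\<in>?A. ?b (\<omega> k)) / 8 ^ (K + 1)))"
  proof (rule integral_mono_AE[OF int int], rule AE_pmfI)
    fix \<omega> assume "\<omega> \<in> set_pmf ?P"
    then have "\<omega> k \<in> set_pmf q" if "k \<in> ?A" for k
      using that by (auto simp: set_Pi_pmf PiE_dflt_def)
    then have "cmod (a - Q (\<omega> k)) \<le> E" if "k < 2 * K + 1" for k
      using that E by simp
    then show "cmod (a - median_complex (map (\<lambda>k. Q (\<omega> k)) [0..<2*K+1]))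
        \<le> 4 / real (K + 1) * (\<Sum>k\<in>?A. ?g (\<omega> k)) + 2 * E * ((\<Prod>k\<in>?A. ?b (\<omega> k)) / 8 ^ (K + 1))"
      by (rule median_complex_deviation_le)
  qed
  also have "\<dots> = 4 / real (K + 1) * (\<Sum>k\<in>?A. measure_pmf.expectation ?P (\<lambda>\<omega>. ?g (\<omega> k)))
        + 2 * E * (measure_pmf.expectation ?P (\<lambda>\<omega>. \<Prod>k\<in>?A. ?b (\<omega> k)) / 8 ^ (K + 1))"
    by (simp only: Bochner_Integration.integral_add[OF int int] integral_mult_right_zero
        integral_divide_zero Bochner_Integration.integral_sum[OF int])
  also have "(\<Sum>k\<in>?A. measure_pmf.expectation ?P (\<lambda>\<omega>. ?g (\<omega> k)))
      = real (2 * K + 1) * measure_pmf.expectation q ?g"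
    using expectation_Pi_pmf_component[of ?A _ dflt "\<lambda>_. q" ?g] by simp
  also have "measure_pmf.expectation ?P (\<lambda>\<omega>. \<Prod>k\<in>?A. ?b (\<omega> k))
      = measure_pmf.expectation q ?b ^ (2 * K + 1)"
    using expectation_prod_Pi_pmf[of ?A "\<lambda>_. q" "\<lambda>_. ?b" dflt] intq by simp
  also have "4 / real (K + 1) * (real (2 * K + 1) * measure_pmf.expectation q ?g) \<le> 8 * T"
  proof -
    have "4 / real (K + 1) * real (2 * K + 1) \<le> 8" by (simp add: field_simps)
    then have "4 / real (K + 1) * real (2 * K + 1) * measure_pmf.expectation q ?g \<le> 8 * T"
      using T T0 by (intro mult_mono) (auto intro!: Bochner_Integration.integral_nonneg)
    then show ?thesis by (simp only: mult.assoc)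
  qed
  also have "2 * E * (measure_pmf.expectation q ?b ^ (2 * K + 1) / 8 ^ (K + 1)) \<le> E / 2 ^ K"
  proof -
    \<comment> \<open>The weight 1 + 63 occurs with probability at most 1/64, so the mean is at most
      1 + 63/64 < 2. Then 4^K against 8^K leaves the decay 2^(-K).\<close>
    have "?b = (\<lambda>x. 1 + 63 * indicator {x. bad x} x)" by (auto simp: indicator_def)
    then have "measure_pmf.expectation q ?b = 1 + 63 * measure_pmf.prob q {x. bad x}"
      by (simp add: intq)
    then have "measure_pmf.expectation q ?b \<le> 2" "0 \<le> measure_pmf.expectation q ?b"
      using bad by simp_all
    then have "measure_pmf.expectation q ?b ^ (2 * K + 1) \<le> 2 ^ (2 * K + 1)"
      by (rule power_mono)
    then have "2 * E * (measure_pmf.expectation q ?b ^ (2 * K + 1) / 8 ^ (K + 1))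
        \<le> 2 * E * (2 ^ (2 * K + 1) / 8 ^ (K + 1))"
      using E0 by (intro mult_left_mono divide_right_mono) auto
    also have "\<dots> = E / 2 ^ K / 2"
    proof -
      have "(8::real) ^ K = 2 ^ (2 * K) * 2 ^ K"
        using power_mult_distrib[of "4::real" 2 K] by (simp add: power_mult)
      then show ?thesis by (simp add: field_simps)
    qed
    also have "\<dots> \<le> E / 2 ^ K"
    proof -
      have "x / 2 \<le> x" if "0 \<le> x" for x :: real using that by simp
      moreover have "0 \<le> E / 2 ^ K" using E0 by simp
      ultimately show ?thesis by blast
    qed
    finally show ?thesis .
  qed
  finally show ?thesis by simp
qed

section \<open>Korobov weights\<close>

lemma summable_zeta_real:
  assumes "s > 1"
  shows "summable (\<lambda>m. 1 / real (Suc m) powr s)"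
proof -
  have "summable (\<lambda>n. real n powr (- s))"
    using assms by (subst summable_real_powr_iff) auto
  then have "summable (\<lambda>n. real (Suc n) powr (- s))"
    by (subst summable_Suc_iff)
  then show ?thesis by (simp add: powr_minus_divide)
qed

lemma sum_powr_le_zeta_real:
  assumes "s > 1" "finite S" "0 \<notin> S"
  shows "(\<Sum>m\<in>S. real m powr (- s)) \<le> zeta_real s"
proof -
  \<comment> \<open>\<open>zeta_real\<close> sums over \<open>Suc m\<close>, hence the shift by one,
    which is injective because 0 is excluded.\<close>
  have inj: "inj_on (\<lambda>m. m - 1) S"
    using assms(3) by (auto intro!: inj_onI) (metis Suc_pred gr0I)
  have "(\<Sum>m\<in>S. real m powr (- s)) = (\<Sum>m\<in>S. 1 / real (Suc (m - 1)) powr s)"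
  proof (rule sum.cong)
    fix m assume "m \<in> S"
    then have "m \<noteq> 0" using assms(3) by metis
    then show "real m powr (- s) = 1 / real (Suc (m - 1)) powr s"
      by (simp add: powr_minus_divide)
  qed simp
  also have "\<dots> = (\<Sum>i\<in>(\<lambda>m. m - 1) ` S. 1 / real (Suc i) powr s)"
    by (subst sum.reindex[OF inj]) (simp only: o_def)
  also have "\<dots> \<le> zeta_real s"
    unfolding zeta_real_def using assms summable_zeta_real[of s] by (intro sum_le_suminf) auto
  finally show ?thesis .
qed

lemma zeta_real_ge_1: "s > 1 \<Longrightarrow> zeta_real s \<ge> 1"
  using sum_powr_le_zeta_real[of s "{1}"] by simp

text \<open>The absolute value is injective on positive and on negative integers; each sign costs
  one zeta value.\<close>

lemma sum_abs_powr_le_zeta_real: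
  assumes "s > 1" "finite B" "0 \<notin> B"
  shows "(\<Sum>k\<in>B. \<bar>real_of_int k\<bar> powr (- s)) \<le> 2 * zeta_real s"
proof -
  have *: "(\<Sum>k\<in>C. \<bar>real_of_int k\<bar> powr (- s)) \<le> zeta_real s"
    if "finite C" "0 \<notin> C" "inj_on (\<lambda>k. nat \<bar>k\<bar>) C" for C
  proof -
    have "(\<Sum>k\<in>C. \<bar>real_of_int k\<bar> powr (- s)) = (\<Sum>m\<in>(\<lambda>k. nat \<bar>k\<bar>) ` C. real m powr (- s))"
      by (simp add: sum.reindex[OF that(3)])
    also have "\<dots> \<le> zeta_real s"
      using assms(1) that by (intro sum_powr_le_zeta_real) auto
    finally show ?thesis .
  qed
  have "B = {k \<in> B. k > 0} \<union> {k \<in> B. k < 0}" using assms(3) by (auto, metis linorder_neqE_linordered_idom)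
  then have "(\<Sum>k\<in>B. \<bar>real_of_int k\<bar> powr (- s))
      = (\<Sum>k\<in>{k \<in> B. k > 0}. \<bar>real_of_int k\<bar> powr (- s)) + (\<Sum>k\<in>{k \<in> B. k < 0}. \<bar>real_of_int k\<bar> powr (- s))"
    using assms(2) sum.union_disjoint[of "{k \<in> B. k > 0}" "{k \<in> B. k < 0}" "\<lambda>k. \<bar>real_of_int k\<bar> powr (- s)"]
    by force
  also have "\<dots> \<le> zeta_real s + zeta_real s"
    using assms(2) by (intro add_mono *) (auto intro!: inj_onI)
  finally show ?thesis by simp
qed

section \<open>Weighted frequencies and the sum V\<close>

locale korobov_weights =
  fixes d :: nat and \<alpha> :: real and \<gamma> :: "nat set \<Rightarrow> real" and lam :: real
  assumes d_pos: "1 \<le> d"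
    and lam_gt: "1/2 < lam" and lam_less: "lam < \<alpha>"
    and weights: "finite u \<Longrightarrow> 0 < \<gamma> u \<and> \<gamma> u \<le> 1"
begin

abbreviation V :: real where
  "V \<equiv> V_d d (\<alpha> / lam) (\<lambda>u. \<gamma> u powr (1 / lam))"

abbreviation r :: "(nat \<Rightarrow> int) \<Rightarrow> real" where
  "r \<equiv> r_weight d \<alpha> \<gamma>"

abbreviation freqs :: "(nat \<Rightarrow> int) set" where
  "freqs \<equiv> Zd d - {\<lambda>_. 0}"

lemma exponent_gt_1: "\<alpha> / lam > 1"
  using lam_gt lam_less by simp

lemma finite_supp: "finite (supp d h)"
  by (simp add: supp_def)

lemma weight_pos: "0 < \<gamma> (supp d h)" and weight_le_1: "\<gamma> (supp d h) \<le> 1"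
  using weights[OF finite_supp] by auto

lemma prod_abs_eq: "(\<Prod>j\<in>supp d h. \<bar>real_of_int (h j)\<bar> powr \<alpha>) = \<gamma> (supp d h) * r h"
  using weight_pos[of h] by (simp add: r_weight_def)

lemma one_le_abs_powr:
  assumes "j \<in> supp d h" "0 \<le> a"
  shows "1 \<le> \<bar>real_of_int (h j)\<bar> powr a"
  using assms by (intro ge_one_powr_ge_zero) (auto simp: supp_def)

lemma abs_powr_le_r:
  assumes "j \<in> supp d h"
  shows "\<bar>real_of_int (h j)\<bar> powr \<alpha> \<le> \<gamma> (supp d h) * r h"
proof -
  have "\<bar>real_of_int (h j)\<bar> powr \<alpha> * 1
      \<le> \<bar>real_of_int (h j)\<bar> powr \<alpha> * (\<Prod>j\<in>supp d h - {j}. \<bar>real_of_int (h j)\<bar> powr \<alpha>)"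
    using lam_gt lam_less by (intro mult_left_mono prod_ge_1 one_le_abs_powr) auto
  also have "\<dots> = (\<Prod>j\<in>supp d h. \<bar>real_of_int (h j)\<bar> powr \<alpha>)"
    using assms finite_supp by (subst prod.remove[of _ j]) auto
  finally show ?thesis by (simp add: prod_abs_eq)
qed

lemma r_ge_1: "1 \<le> r h"
proof -
  have "1 \<le> (\<Prod>j\<in>supp d h. \<bar>real_of_int (h j)\<bar> powr \<alpha>)"
    using lam_gt lam_less by (intro prod_ge_1 one_le_abs_powr) auto
  also have "\<dots> \<le> 1 * r h"
    unfolding prod_abs_eq using weight_le_1 weight_pos[of h]
    by (intro mult_right_mono) (auto simp: r_weight_def intro!: mult_nonneg_nonneg prod_nonneg)
  finally show ?thesis by simp
qed

lemma r_pos: "0 < r h"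
  using r_ge_1[of h] by linarith

lemma supp_nonempty:
  assumes "h \<in> freqs"
  shows "supp d h \<noteq> {}"
proof -
  obtain j where "h j \<noteq> 0" using assms by (auto simp: fun_eq_iff)
  then have "j \<in> supp d h" using assms by (force simp: Zd_def supp_def)
  then show ?thesis by blast
qed

text \<open>This form factorizes over the coordinates, which is what turns a sum over frequencies
  into the powers of zeta in \<open>V\<close>.\<close>

lemma r_powr_neg:
  "r h powr (- (1 / lam)) =
     \<gamma> (supp d h) powr (1 / lam) * (\<Prod>j\<in>supp d h. \<bar>real_of_int (h j)\<bar> powr (- (\<alpha> / lam)))"
proof -
  let ?P = "\<Prod>j\<in>supp d h. \<bar>real_of_int (h j)\<bar> powr \<alpha>"
  have P: "0 < ?P" by (intro prod_pos) (auto simp: supp_def)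
  have "r h powr (- (1 / lam)) = inverse (\<gamma> (supp d h)) powr (- (1 / lam)) * ?P powr (- (1 / lam))"
    unfolding r_weight_def using weight_pos[of h] P by (simp add: powr_mult)
  also have "inverse (\<gamma> (supp d h)) powr (- (1 / lam)) = \<gamma> (supp d h) powr (1 / lam)"
    using weight_pos[of h] by (simp add: powr_minus inverse_powr)
  also have "?P powr (- (1 / lam)) = (\<Prod>j\<in>supp d h. \<bar>real_of_int (h j)\<bar> powr (- (\<alpha> / lam)))"
    by (subst prod_powr_distrib) (auto simp: powr_powr)
  finally show ?thesis .
qed

text \<open>One summand of \<open>V\<close> is kept; its zeta factor is at least 1.\<close>

lemma weight_powr_le_V:
  assumes "u \<subseteq> {1..d}" "u \<noteq> {}"
  shows "\<gamma> u powr (1 / lam) \<le> V"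
proof -
  have z: "2 * zeta_real (\<alpha> / lam) \<ge> 1" using zeta_real_ge_1[OF exponent_gt_1] by linarith
  have "\<gamma> u powr (1 / lam) * 1 \<le> \<gamma> u powr (1 / lam) * (2 * zeta_real (\<alpha> / lam)) ^ card u"
    using z by (intro mult_left_mono one_le_power) auto
  also have "\<dots> \<le> V"
    unfolding V_d_def using assms z
    by (intro member_le_sum[of u _ "\<lambda>u. \<gamma> u powr (1 / lam) * (2 * zeta_real (\<alpha> / lam)) ^ card u"]) auto
  finally show ?thesis by simp
qed

lemma V_pos: "0 < V"
proof -
  have "0 < \<gamma> {1} powr (1 / lam)" using weights[of "{1}"] by simp
  also have "\<dots> \<le> V" using d_pos by (intro weight_powr_le_V) auto
  finally show ?thesis .
qed

lemma weight_le_V: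
  assumes "h \<in> freqs"
  shows "\<gamma> (supp d h) \<le> V powr lam"
proof -
  have "\<gamma> (supp d h) = (\<gamma> (supp d h) powr (1 / lam)) powr lam"
    using lam_gt weight_pos[of h] by (simp add: powr_powr)
  also have "\<dots> \<le> V powr lam"
    using supp_nonempty[OF assms] lam_gt
    by (intro powr_mono2 weight_powr_le_V) (auto simp: supp_def)
  finally show ?thesis .
qed

text \<open>The weight is bounded by \<open>V powr lam\<close> and not just by 1: the coordinates
  then scale with \<open>V\<close>, and later constants stay free of \<open>d\<close> and
  \<open>\<gamma>\<close>.\<close>

lemma abs_powr_le_V_r:
  assumes "h \<in> freqs" "j \<in> supp d h"
  shows "\<bar>real_of_int (h j)\<bar> powr \<alpha> \<le> V powr lam * r h"
  using abs_powr_le_r[OF assms(2)] mult_right_mono[OF weight_le_V[OF assms(1)], of "r h"] r_pos[of h]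
  by linarith

text \<open>Frequencies are grouped by their support \<open>u\<close>, and each group is enlarged to
  a full box. There the sum of products becomes a product of sums, one factor of at most
  \<open>2 * zeta_real (\<alpha> / lam)\<close> per coordinate in \<open>u\<close>.\<close>

lemma sum_r_powr_le_V:
  assumes "finite F" "F \<subseteq> freqs"
  shows "(\<Sum>h\<in>F. r h powr (- (1 / lam))) \<le> V"
proof -
  \<comment> \<open>All nonzero values taken by frequencies in \<open>F\<close>; this keeps the
    boxes finite.\<close>
  define B where "B = (\<Union>h\<in>F. h ` {1..d}) - {0}"
  define \<phi> where "\<phi> = (\<lambda>k. \<bar>real_of_int k\<bar> powr (- (\<alpha> / lam)))"
  let ?U = "{u. u \<subseteq> {1..d} \<and> u \<noteq> {}}"
  have finB: "finite B" using assms(1) by (simp add: B_def)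
  have finU: "finite ?U" by (rule finite_subset[of _ "Pow {1..d}"]) auto
  have "(\<Sum>h\<in>F. r h powr (- (1 / lam)))
      = (\<Sum>u\<in>?U. \<Sum>h\<in>{h \<in> F. supp d h = u}. r h powr (- (1 / lam)))"
  proof (rule sum.group[symmetric, OF assms(1) finU])
    show "supp d ` F \<subseteq> ?U"
    proof (intro image_subsetI CollectI conjI)
      fix h assume "h \<in> F"
      then show "supp d h \<noteq> {}" using assms(2) supp_nonempty by blast
    qed (auto simp: supp_def)
  qed
  also have "\<dots> \<le> (\<Sum>u\<in>?U. \<gamma> u powr (1 / lam) * (2 * zeta_real (\<alpha> / lam)) ^ card u)"
  proof (rule sum_mono)
    fix u assume u: "u \<in> ?U"
    then have finu: "finite u" using finite_subset by auto
    let ?G = "{h \<in> F. supp d h = u}"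
    \<comment> \<open>Off \<open>u\<close> these frequencies all vanish, so the restriction forgets
      nothing.\<close>
    have inj: "inj_on (\<lambda>h. restrict h u) ?G"
    proof (rule inj_onI, rule ext)
      fix h h' j assume h: "h \<in> ?G" "h' \<in> ?G" and eq: "restrict h u = restrict h' u"
      show "h j = h' j"
      proof (cases "j \<in> u")
        case True
        then show ?thesis using fun_cong[OF eq, of j] by simp
      next
        case False
        then have "h j = 0" "h' j = 0" using h assms(2) by (auto simp: supp_def Zd_def)
        then show ?thesis by simp
      qed
    qed
    have "(\<Sum>h\<in>?G. r h powr (- (1 / lam))) = (\<Sum>h\<in>?G. \<gamma> u powr (1 / lam) * (\<Prod>j\<in>u. \<phi> (h j)))"
      by (intro sum.cong) (auto simp: r_powr_neg \<phi>_def)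
    also have "\<dots> = \<gamma> u powr (1 / lam) * (\<Sum>h\<in>?G. \<Prod>j\<in>u. \<phi> (restrict h u j))"
      by (simp add: sum_distrib_left)
    also have "(\<Sum>h\<in>?G. \<Prod>j\<in>u. \<phi> (restrict h u j)) = (\<Sum>g\<in>(\<lambda>h. restrict h u) ` ?G. \<Prod>j\<in>u. \<phi> (g j))"
      by (simp add: sum.reindex[OF inj])
    also have "\<dots> \<le> (\<Sum>g\<in>PiE u (\<lambda>_. B). \<Prod>j\<in>u. \<phi> (g j))"
    proof (rule sum_mono2)
      show "finite (PiE u (\<lambda>_. B))" using finu finB by (intro finite_PiE)
      show "(\<lambda>h. restrict h u) ` ?G \<subseteq> PiE u (\<lambda>_. B)"
        by (auto simp: B_def supp_def)
    qed (auto simp: \<phi>_def intro: prod_nonneg)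
    also have "\<dots> = (\<Prod>j\<in>u. \<Sum>k\<in>B. \<phi> k)"
      using finu finB by (subst prod_sum_PiE) auto
    also have "\<dots> = (\<Sum>k\<in>B. \<phi> k) ^ card u" by simp
    also have "\<dots> \<le> (2 * zeta_real (\<alpha> / lam)) ^ card u"
      unfolding \<phi>_def using exponent_gt_1 finB
      by (intro power_mono sum_abs_powr_le_zeta_real sum_nonneg) (auto simp: B_def)
    finally show "(\<Sum>h\<in>?G. r h powr (- (1 / lam))) \<le> \<gamma> u powr (1 / lam) * (2 * zeta_real (\<alpha> / lam)) ^ card u"
      by (simp add: mult_left_mono)
  qed
  finally show ?thesis by (simp add: V_d_def)
qed

text \<open>With x = r(h)^(-1/lam) the summand is x^(2 lam). Each x is itself at most V, and 2 lam >
  1, so all but one power of x can be replaced by V.\<close>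

lemma sum_inverse_r_squared_le:
  assumes "finite F" "F \<subseteq> freqs"
  shows "(\<Sum>h\<in>F. (1 / r h)\<^sup>2) \<le> V powr (2 * lam)"
proof -
  have "(\<Sum>h\<in>F. (1 / r h)\<^sup>2) \<le> (\<Sum>h\<in>F. r h powr (- (1 / lam)) * V powr (2 * lam - 1))"
  proof (rule sum_mono)
    fix h assume h: "h \<in> F"
    define x where "x = r h powr (- (1 / lam))"
    have x: "0 < x" using r_pos[of h] by (simp add: x_def)
    have "x \<le> V"
      using sum_r_powr_le_V[of "{h}"] h assms(2) by (auto simp: x_def)
    have "(1 / r h)\<^sup>2 = r h powr (- 2)"
      using r_pos[of h] by (simp add: powr_minus_divide power_divide)
    also have "\<dots> = x powr (2 * lam)"
      using lam_gt by (simp add: x_def powr_powr)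
    also have "\<dots> = x * x powr (2 * lam - 1)"
      using x by (simp add: powr_diff)
    also have "\<dots> \<le> x * V powr (2 * lam - 1)"
      using \<open>x \<le> V\<close> x lam_gt by (intro mult_left_mono powr_mono2) auto
    finally show "(1 / r h)\<^sup>2 \<le> r h powr (- (1 / lam)) * V powr (2 * lam - 1)"
      by (simp add: x_def)
  qed
  also have "\<dots> \<le> V * V powr (2 * lam - 1)"
    unfolding sum_distrib_right[symmetric] using sum_r_powr_le_V[OF assms]
    by (intro mult_right_mono) auto
  also have "\<dots> = V powr (2 * lam)"
    using V_pos by (simp add: powr_diff)
  finally show ?thesis .
qed

text \<open>Cauchy-Schwarz with \<open>r h\<close> moved onto the coefficient and
  \<open>w h / r h\<close> left over. The free \<open>w\<close> covers both the worst-case error,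
  with w = 1, and the mean error, with w the probability of being dual.\<close>

lemma sum_fourier_coeff_le:
  assumes f: "in_korobov d \<alpha> \<gamma> f" and F: "finite F" "F \<subseteq> freqs" and w: "\<And>h. h \<in> F \<Longrightarrow> 0 \<le> w h"
    and B: "(\<Sum>h\<in>F. (w h / r h)\<^sup>2) \<le> B\<^sup>2" "0 \<le> B"
  shows "(\<Sum>h\<in>F. cmod (fourier_coeff d f h) * w h) \<le> korobov_norm d \<alpha> \<gamma> f * B"
proof -
  have "(\<Sum>h\<in>F. cmod (fourier_coeff d f h) * w h)
      = (\<Sum>h\<in>F. \<bar>r h * cmod (fourier_coeff d f h)\<bar> * \<bar>w h / r h\<bar>)"
    using r_pos w by (intro sum.cong) (auto simp: abs_mult less_imp_neq[symmetric])
  also have "\<dots> \<le> L2_set (\<lambda>h. r h * cmod (fourier_coeff d f h)) F * L2_set (\<lambda>h. w h / r h) F"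
    by (rule L2_set_mult_ineq)
  also have "\<dots> \<le> korobov_norm d \<alpha> \<gamma> f * B"
  proof (rule mult_mono)
    show "L2_set (\<lambda>h. r h * cmod (fourier_coeff d f h)) F \<le> korobov_norm d \<alpha> \<gamma> f"
      unfolding L2_set_def korobov_norm_def power_mult_distrib
      using f F by (intro real_sqrt_le_mono finite_sum_le_infsum) (auto simp: in_korobov_def)
    show "L2_set (\<lambda>h. w h / r h) F \<le> B"
      unfolding L2_set_def using B real_sqrt_le_mono[OF B(1)] by simp
  qed (auto simp: korobov_norm_def intro!: infsum_nonneg)
  finally show ?thesis .
qed

end

section \<open>Lattice rules and dual lattices\<close>

definition lattice_dual :: "nat \<Rightarrow> nat \<Rightarrow> (nat \<Rightarrow> nat) \<Rightarrow> (nat \<Rightarrow> int) set" where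
  "lattice_dual d p z = {h. int p dvd (\<Sum>j\<in>{1..d}. h j * int (z j))}"

lemma has_sum_finite_sum:
  fixes f :: "'b \<Rightarrow> 'a \<Rightarrow> 'c :: topological_comm_monoid_add"
  assumes "\<And>x. x \<in> A \<Longrightarrow> (f x has_sum s x) B"
  shows "((\<lambda>h. \<Sum>x\<in>A. f x h) has_sum (\<Sum>x\<in>A. s x)) B"
  using assms by (induction A rule: infinite_finite_induct) (auto intro!: has_sum_add)

text \<open>Taking fractional parts changes the phase by whole turns only, so along the lattice a
  character runs through the powers of one \<open>p\<close>-th root of unity.\<close>

lemma char_e_lattice_point:
  assumes "p > 0"
  shows "char_e d h (\<lambda>j\<in>{1..d}. frac (real k * real (z j) / real p))
     = cis (2 * pi * (real_of_int (\<Sum>j\<in>{1..d}. h j * int (z j)) / real p)) ^ k"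
proof -
  let ?y = "\<lambda>j. real k * real (z j) / real p"
  define m where "m = (\<Sum>j\<in>{1..d}. h j * \<lfloor>?y j\<rfloor>)"
  define a where "a = real_of_int (\<Sum>j\<in>{1..d}. h j * int (z j)) / real p"
  have "(\<Sum>j\<in>{1..d}. real_of_int (h j) * frac (?y j))
      = (\<Sum>j\<in>{1..d}. real_of_int (h j) * ?y j) - of_int m"
    by (simp add: m_def frac_def algebra_simps sum_subtractf)
  also have "(\<Sum>j\<in>{1..d}. real_of_int (h j) * ?y j) = real k * a"
    by (simp add: a_def sum_distrib_left sum_divide_distrib algebra_simps)
  finally have "2 * pi * (\<Sum>j\<in>{1..d}. real_of_int (h j) * frac (?y j)) = real k * (2 * pi * a) - 2 * pi * of_int m"
    by (simp only: right_diff_distrib mult_ac)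
  then have "char_e d h (\<lambda>j\<in>{1..d}. frac (?y j)) = cis (real k * (2 * pi * a) - 2 * pi * of_int m)"
    by (simp add: char_e_def)
  also have "\<dots> = cis (2 * pi * a) ^ k"
    by (simp add: Complex.DeMoivre flip: cis_divide)
  finally show ?thesis by (simp add: a_def)
qed

lemma sum_roots_of_unity:
  assumes "p > 0"
  shows "(\<Sum>k<p. cis (2 * pi * (real_of_int a / real p)) ^ k) = (if int p dvd a then of_nat p else 0)"
proof (cases "int p dvd a")
  case True
  then obtain b where "a = int p * b" by blast
  then have "real_of_int a / real p = of_int b" using assms by simp
  then have "cis (2 * pi * (real_of_int a / real p)) = 1" by (simp only: cis_multiple_2pi Ints_of_int)
  then show ?thesis using True by simp
next
  case False
  let ?w = "cis (2 * pi * (real_of_int a / real p))"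
  have "?w \<noteq> 1"
  proof
    assume "?w = 1"
    then have "cos (2 * pi * (real_of_int a / real p)) = 1" by (simp add: complex_eq_iff)
    then obtain b where "2 * pi * (real_of_int a / real p) = of_int b * 2 * pi"
      by (auto simp: cos_one_2pi_int)
    then have "2 * pi * (real_of_int a / real p) = 2 * pi * of_int b" by (simp only: mult_ac)
    then have "real_of_int a / real p = of_int b"
      by (rule mult_left_cancel[THEN iffD1, rotated]) simp
    then have "real_of_int a = of_int (int p * b)" using assms by (simp add: field_simps)
    then have "a = int p * b" by (simp only: of_int_eq_iff)
    then show False using False by simp
  qed
  moreover have "?w ^ p = 1"
  proof -
    have "?w ^ p = cis (2 * pi * of_int a)" using assms by (simp add: Complex.DeMoivre)
    then show ?thesis by (simp only: cis_multiple_2pi Ints_of_int)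
  qed
  ultimately show ?thesis using False by (simp add: geometric_sum)
qed

lemma norm_char_e: "cmod (char_e d h x) = 1"
  by (simp add: char_e_def)

text \<open>Aliasing: summing over a lattice annihilates every frequency outside the dual lattice.\<close>

lemma has_sum_lattice_rule:
  assumes f: "in_korobov d \<alpha> \<gamma> f" and p: "p > 0"
  shows "((\<lambda>h. if h \<in> lattice_dual d p z then fourier_coeff d f h else 0)
     has_sum lattice_rule d p z f) (Zd d)"
proof -
  define x where "x = (\<lambda>k. \<lambda>j\<in>{1..d}. frac (real k * real (z j) / real p))"
  have "((\<lambda>h. fourier_coeff d f h * char_e d h (x k)) has_sum f (x k)) (Zd d)" for k
  proof -
    have "(\<lambda>h. cmod (fourier_coeff d f h * char_e d h (x k))) summable_on Zd d"
      using f[unfolded in_korobov_def, THEN conjunct1] by (simp add: norm_mult norm_char_e)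
    then have "(\<lambda>h. fourier_coeff d f h * char_e d h (x k)) summable_on Zd d"
      by (rule abs_summable_summable)
    moreover
    \<comment> \<open>The pointwise Fourier expansion of \<open>f\<close> is available on the cube,
      so the lattice points must be located there.\<close>
    have "x k \<in> space (unit_cube d)"
    proof -
      have "space (unit_cube d) = PiE {1..d} (\<lambda>_. {0..1})"
        by (simp add: unit_cube_def space_PiM space_restrict_space)
      then show ?thesis
        unfolding x_def by (simp only: restrict_PiE_iff) (simp add: frac_lt_1 less_imp_le)
    qed
    then have "f (x k) = (\<Sum>\<^sub>\<infinity>h\<in>Zd d. fourier_coeff d f h * char_e d h (x k))"
      by (rule f[unfolded in_korobov_def, THEN conjunct2, THEN conjunct1, THEN bspec])
    ultimately show ?thesis by (simp only: has_sum_infsum)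
  qed
  then have "((\<lambda>h. (\<Sum>k<p. fourier_coeff d f h * char_e d h (x k)) * (1 / of_nat p))
      has_sum (\<Sum>k<p. f (x k)) * (1 / of_nat p)) (Zd d)"
    by (intro has_sum_cmult_left has_sum_finite_sum)
  moreover have "(\<Sum>k<p. fourier_coeff d f h * char_e d h (x k)) * (1 / of_nat p)
      = (if h \<in> lattice_dual d p z then fourier_coeff d f h else 0)" for h
    unfolding x_def char_e_lattice_point[OF p] sum_distrib_left[symmetric] sum_roots_of_unity[OF p]
    using p by (simp add: lattice_dual_def)
  ultimately show ?thesis
    by (simp add: lattice_rule_def x_def)
qed

text \<open>The zero frequency is dual to every lattice and its coefficient is the integral, so
  deleting it from the aliasing sum leaves the error. Summability is recorded for the later passage
  to finite partial sums.\<close>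

lemma lattice_rule_error_le:
  assumes f: "in_korobov d \<alpha> \<gamma> f" and p: "p > 0"
  shows "cmod (I_d d f - lattice_rule d p z f)
     \<le> (\<Sum>\<^sub>\<infinity>h\<in>Zd d - {\<lambda>_. 0}. if h \<in> lattice_dual d p z then cmod (fourier_coeff d f h) else 0)"
    and "(\<lambda>h. if h \<in> lattice_dual d p z then cmod (fourier_coeff d f h) else 0) summable_on (Zd d - {\<lambda>_. 0})"
proof -
  let ?g = "\<lambda>h. if h \<in> lattice_dual d p z then fourier_coeff d f h else 0"
  have norm: "(\<lambda>h. if h \<in> lattice_dual d p z then cmod (fourier_coeff d f h) else 0) = (\<lambda>h. cmod (?g h))"
    by auto
  have I: "I_d d f = fourier_coeff d f (\<lambda>_. 0)"
    by (simp add: I_d_def fourier_coeff_def char_e_def)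
  have "(\<lambda>h. cmod (fourier_coeff d f h)) summable_on (Zd d - {\<lambda>_. 0})"
    using f[unfolded in_korobov_def, THEN conjunct1] by (rule summable_on_subset) blast
  then show abs: "(\<lambda>h. if h \<in> lattice_dual d p z then cmod (fourier_coeff d f h) else 0) summable_on (Zd d - {\<lambda>_. 0})"
    by (rule summable_on_comparison_test) auto
  have sum: "?g summable_on (Zd d - {\<lambda>_. 0})"
    using abs unfolding norm by (rule abs_summable_summable)
  have "lattice_rule d p z f = (\<Sum>\<^sub>\<infinity>h\<in>Zd d. ?g h)"
    using has_sum_lattice_rule[OF f p, of z] by (simp add: infsumI)
  also have "Zd d = insert (\<lambda>_. 0) (Zd d - {\<lambda>_. 0})"
    by (auto simp: Zd_def)
  also have "(\<Sum>\<^sub>\<infinity>h\<in>\<dots>. ?g h) = I_d d f + (\<Sum>\<^sub>\<infinity>h\<in>Zd d - {\<lambda>_. 0}. ?g h)"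
    using sum by (subst infsum_insert) (auto simp: I lattice_dual_def)
  finally have "cmod (I_d d f - lattice_rule d p z f) = cmod (\<Sum>\<^sub>\<infinity>h\<in>Zd d - {\<lambda>_. 0}. ?g h)"
    by simp
  also have "\<dots> \<le> (\<Sum>\<^sub>\<infinity>h\<in>Zd d - {\<lambda>_. 0}. cmod (?g h))"
    using abs unfolding norm by (rule norm_infsum_bound)
  finally show "cmod (I_d d f - lattice_rule d p z f)
     \<le> (\<Sum>\<^sub>\<infinity>h\<in>Zd d - {\<lambda>_. 0}. if h \<in> lattice_dual d p z then cmod (fourier_coeff d f h) else 0)"
    unfolding norm .
qed

section \<open>The probability that a frequency is dual\<close>

text \<open>As \<open>p\<close> does not divide \<open>h j\<close>, duality determines
  \<open>z j\<close> modulo \<open>p\<close> from the other coordinates, and elements of {1..p-1}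
  are distinct modulo \<open>p\<close>.\<close>

lemma card_lattice_dual_generators_le:
  assumes p: "prime p" and j: "j \<in> {1..d}" and h: "\<not> int p dvd h j"
  shows "card {z \<in> PiE {1..d} (\<lambda>_. {1..p-1}). h \<in> lattice_dual d p z} \<le> (p - 1) ^ (d - 1)"
proof -
  let ?S = "{z \<in> PiE {1..d} (\<lambda>_. {1..p-1}). h \<in> lattice_dual d p z}"
  have "inj_on (\<lambda>z. restrict z ({1..d} - {j})) ?S"
  proof (rule inj_onI)
    fix z z' assume z: "z \<in> ?S" "z' \<in> ?S"
      and eq: "restrict z ({1..d} - {j}) = restrict z' ({1..d} - {j})"
    have off: "z i = z' i" if "i \<in> {1..d} - {j}" for i
      using fun_cong[OF eq, of i] that by simp
    have split: "(\<Sum>i\<in>{1..d}. h i * int (w i)) = h j * int (w j) + (\<Sum>i\<in>{1..d} - {j}. h i * int (w i))" for w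
      using j by (simp add: sum.remove)
    have "(\<Sum>i\<in>{1..d} - {j}. h i * int (z i)) = (\<Sum>i\<in>{1..d} - {j}. h i * int (z' i))"
      using off by (intro sum.cong) auto
    then have "(\<Sum>i\<in>{1..d}. h i * int (z i)) - (\<Sum>i\<in>{1..d}. h i * int (z' i)) = h j * (int (z j) - int (z' j))"
      unfolding split by (simp add: algebra_simps)
    moreover have "int p dvd (\<Sum>i\<in>{1..d}. h i * int (z i)) - (\<Sum>i\<in>{1..d}. h i * int (z' i))"
      using z by (intro dvd_diff) (auto simp: lattice_dual_def)
    ultimately have "int p dvd h j * (int (z j) - int (z' j))" by simp
    then have dvd: "int p dvd int (z j) - int (z' j)"
      using p h by (simp add: prime_dvd_mult_iff)
    have "z j \<in> {1..p-1}" "z' j \<in> {1..p-1}" using z j by (auto dest: PiE_mem)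
    then have "\<bar>int (z j) - int (z' j)\<bar> < int p" by auto
    then have "int (z j) - int (z' j) = 0"
      using dvd zdvd_not_zless[of "\<bar>int (z j) - int (z' j)\<bar>" "int p"] by fastforce
    then have zj: "z j = z' j" by simp
    show "z = z'"
    proof (rule PiE_ext)
      show "z \<in> PiE {1..d} (\<lambda>_. {1..p-1})" "z' \<in> PiE {1..d} (\<lambda>_. {1..p-1})" using z by auto
      show "z i = z' i" if "i \<in> {1..d}" for i using off zj that by (cases "i = j") auto
    qed
  qed
  moreover have "(\<lambda>z. restrict z ({1..d} - {j})) ` ?S \<subseteq> PiE ({1..d} - {j}) (\<lambda>_. {1..p-1})"
  proof (rule image_subsetI)
    fix z assume "z \<in> ?S"
    then have "z i \<in> {1..p-1}" if "i \<in> {1..d}" for i using that PiE_mem by fast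
    then show "restrict z ({1..d} - {j}) \<in> PiE ({1..d} - {j}) (\<lambda>_. {1..p-1})"
      unfolding restrict_PiE_iff by blast
  qed
  ultimately have "card ?S \<le> card (PiE ({1..d} - {j}) (\<lambda>_. {1..p-1}))"
    by (rule card_inj_on_le) (auto intro: finite_PiE)
  also have "\<dots> = (p - 1) ^ (d - 1)"
    using j by (simp add: card_PiE)
  finally show ?thesis .
qed

lemma generators_finite: "finite (PiE {1..d::nat} (\<lambda>_. {1..p - (1::nat)}))"
  by (intro finite_PiE) auto

lemma generators_nonempty:
  assumes "prime (p::nat)"
  shows "PiE {1..d::nat} (\<lambda>_. {1..p - 1}) \<noteq> {}"
  using prime_ge_2_nat[OF assms] by (auto simp: PiE_eq_empty_iff)

text \<open>If \<open>p\<close> divides \<open>h j\<close>, the trivial bound 1 is used. Otherwise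
  fixing the other coordinates leaves at most one of the \<open>p - 1\<close> values of
  \<open>z j\<close>.\<close>

lemma prob_lattice_dual_fixed_prime:
  assumes p: "prime p" and j: "j \<in> {1..d}"
  shows "measure_pmf.prob (map_pmf (\<lambda>z. (p, z)) (pmf_of_set (PiE {1..d} (\<lambda>_. {1..p-1}))))
      {x. h \<in> lattice_dual d (fst x) (snd x)} \<le> (if int p dvd h j then 1 else 0) + 1 / real (p - 1)"
proof (cases "int p dvd h j")
  case True
  then show ?thesis by (simp add: add_increasing2)
next
  case False
  let ?Z = "PiE {1..d} (\<lambda>_. {1..p-1})"
  have p2: "p \<ge> 2" using prime_ge_2_nat[OF p] .
  have d: "d = Suc (d - 1)" using j by simp
  have "measure_pmf.prob (map_pmf (\<lambda>z. (p, z)) (pmf_of_set ?Z)) {x. h \<in> lattice_dual d (fst x) (snd x)}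
      = measure_pmf.prob (pmf_of_set ?Z) {z. h \<in> lattice_dual d p z}"
    by (simp add: vimage_def)
  also have "\<dots> = real (card {z \<in> ?Z. h \<in> lattice_dual d p z}) / real (card ?Z)"
    unfolding measure_pmf_of_set[OF generators_nonempty[OF p] generators_finite]
    by (simp add: Int_def)
  also have "\<dots> \<le> real ((p - 1) ^ (d - 1)) / real (card ?Z)"
    using card_lattice_dual_generators_le[of p j d h, OF p j False]
    by (intro divide_right_mono of_nat_mono) auto
  also have "card ?Z = (p - 1) ^ d" by (simp add: card_PiE)
  also have "real ((p - 1) ^ (d - 1)) / real ((p - 1) ^ d) = 1 / real (p - 1)"
    using p2 by (subst (2) d) simp
  finally show ?thesis using False by simp
qed

lemma prime_in_primes_P:
  assumes "p \<in> primes_P n"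
  shows "prime p" and "real n / 2 \<le> real (p - 1)" and "real n / 2 + 1 \<le> real p"
proof -
  have "nat \<lceil>real n / 2\<rceil> + 1 \<le> p" using assms by (simp add: primes_P_def)
  then show "real n / 2 \<le> real (p - 1)" "real n / 2 + 1 \<le> real p" by linarith+
  show "prime p" using assms by (simp add: primes_P_def)
qed

lemma set_pair_pmf_n:
  assumes "n \<ge> 2"
  shows "finite (set_pmf (pair_pmf_n n d))" "x \<in> set_pmf (pair_pmf_n n d) \<Longrightarrow> fst x \<in> primes_P n"
proof -
  have set: "set_pmf (pair_pmf_n n d) = (\<Union>p\<in>primes_P n. Pair p ` PiE {1..d} (\<lambda>_. {1..p-1}))"
    unfolding pair_pmf_n_def set_bind_pmf set_map_pmf
      set_pmf_of_set[OF primes_P_nonempty[OF assms] finite_primes_P]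
    using prime_in_primes_P(1) generators_nonempty generators_finite by (intro SUP_cong refl) (simp add: set_pmf_of_set)
  show "finite (set_pmf (pair_pmf_n n d))"
    unfolding set by (intro finite_UN_I finite_primes_P finite_imageI generators_finite)
  show "x \<in> set_pmf (pair_pmf_n n d) \<Longrightarrow> fst x \<in> primes_P n"
    unfolding set by auto
qed

text \<open>The fixed-prime bound is averaged over \<open>primes_P n\<close>, where p - 1 \<ge>
  n/2.\<close>

lemma prob_lattice_dual_le:
  assumes n: "n \<ge> 2" and j: "j \<in> {1..d}"
  shows "measure_pmf.prob (pair_pmf_n n d) {x. h \<in> lattice_dual d (fst x) (snd x)}
     \<le> real (card {p \<in> primes_P n. int p dvd h j}) / real (card (primes_P n)) + 2 / real n"
proof -
  let ?P = "primes_P n" and ?A = "{x. h \<in> lattice_dual d (fst x) (snd x)}"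
  let ?q = "\<lambda>p. map_pmf (\<lambda>z. (p, z)) (pmf_of_set (PiE {1..d} (\<lambda>_. {1..p-1})))"
  have card: "real (card ?P) > 0"
    using primes_P_nonempty[OF n] finite_primes_P by (simp add: card_gt_0_iff)
  have fin: "finite (set_pmf (?q p))" if "p \<in> ?P" for p
    using generators_nonempty[OF prime_in_primes_P(1)[OF that], of d] generators_finite[of d p]
    by (simp add: set_pmf_of_set)
  have "measure_pmf.prob (pair_pmf_n n d) ?A = measure_pmf.expectation (pair_pmf_n n d) (indicator ?A)"
    by simp
  also have "\<dots> = (\<Sum>p\<in>?P. measure_pmf.expectation (?q p) (indicator ?A) /\<^sub>R real (card ?P))"
    unfolding pair_pmf_n_def
    by (rule pmf_expectation_bind_pmf_of_set[OF primes_P_nonempty[OF n] finite_primes_P fin])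
  also have "\<dots> = (\<Sum>p\<in>?P. measure_pmf.prob (?q p) ?A / real (card ?P))"
    by (intro sum.cong refl) (simp add: field_simps)
  also have "\<dots> \<le> (\<Sum>p\<in>?P. ((if int p dvd h j then 1 else 0) + 2 / real n) / real (card ?P))"
  proof (intro sum_mono divide_right_mono)
    fix p assume p: "p \<in> ?P"
    have "1 / real (p - 1) \<le> 1 / (real n / 2)"
      using prime_in_primes_P(2)[OF p] n by (intro divide_left_mono) auto
    then show "measure_pmf.prob (?q p) ?A \<le> (if int p dvd h j then 1 else 0) + 2 / real n"
      using prob_lattice_dual_fixed_prime[OF prime_in_primes_P(1)[OF p] j, of h] by simp
  qed (use card in simp)
  also have "\<dots> = real (card {p \<in> ?P. int p dvd h j}) / real (card ?P) + 2 / real n"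
    using card finite_primes_P[of n] primes_P_nonempty[OF n]
    by (simp add: sum_divide_distrib[symmetric] sum.distrib add_divide_distrib sum.If_cases Int_def)
  finally show ?thesis .
qed

lemma prod_primes_dvd:
  assumes "finite A" "\<And>p. p \<in> A \<Longrightarrow> prime p \<and> p dvd m"
  shows "\<Prod>A dvd (m::nat)"
  using assms
proof (induction A rule: finite_induct)
  case (insert p A)
  have "coprime p (\<Prod>A)"
    using insert by (intro prod_coprime_right) (metis insertCI primes_coprime)
  then show ?case using insert by (simp add: divides_mult)
qed simp

text \<open>The product of the counted primes divides \<open>k\<close>, and each of them is at least
  n/2 + 1 \<ge> sqrt n. The factor 2 comes from this square root.\<close>

lemma card_prime_divisors_le:
  assumes n: "n \<ge> 2" and k: "k \<noteq> 0"
  shows "real (card {p \<in> primes_P n. int p dvd k}) * ln (real n) \<le> 2 * ln \<bar>real_of_int k\<bar>"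
proof -
  let ?A = "{p \<in> primes_P n. int p dvd k}"
  have "sqrt (real n) ^ card ?A = (\<Prod>p\<in>?A. sqrt (real n))" by simp
  also have "\<dots> \<le> (\<Prod>p\<in>?A. real p)"
  proof (intro prod_mono conjI)
    fix p assume p: "p \<in> ?A"
    have "real n \<le> (real n / 2 + 1)\<^sup>2" by (simp add: power2_eq_square field_simps)
    then have "sqrt (real n) \<le> real n / 2 + 1" by (intro real_le_lsqrt) auto
    then show "sqrt (real n) \<le> real p" using prime_in_primes_P(3)[of p n] p by simp
  qed simp
  also have "\<dots> = real (\<Prod>?A)" by simp
  also have "\<dots> \<le> real (nat \<bar>k\<bar>)"
  proof (intro of_nat_mono dvd_imp_le prod_primes_dvd)
    show "finite ?A" using finite_primes_P by simp
    show "prime p \<and> p dvd nat \<bar>k\<bar>" if "p \<in> ?A" for p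
      using that prime_in_primes_P(1) by auto
  qed (use k in simp)
  finally have "ln (sqrt (real n) ^ card ?A) \<le> ln \<bar>real_of_int k\<bar>"
    using n k by (subst ln_le_cancel_iff) auto
  then show ?thesis using n by (simp add: ln_realpow ln_sqrt)
qed

section \<open>Error bounds\<close>

context korobov_weights
begin

definition bad_lattice :: "real \<Rightarrow> nat \<times> (nat \<Rightarrow> nat) \<Rightarrow> bool" where
  "bad_lattice t x \<longleftrightarrow> (\<exists>h\<in>freqs. h \<in> lattice_dual d (fst x) (snd x) \<and> r h \<le> t)"

abbreviation dual_prob :: "nat \<Rightarrow> (nat \<Rightarrow> int) \<Rightarrow> real" where
  "dual_prob n h \<equiv> measure_pmf.prob (pair_pmf_n n d) {x. h \<in> lattice_dual d (fst x) (snd x)}"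

abbreviation threshold :: "nat \<Rightarrow> real" where
  "threshold n \<equiv> (real n / (128 * V)) powr lam"

section \<open>Probability that a frequency of given weight is dual\<close>

text \<open>The threshold is scaled so that every nonzero coordinate of \<open>h\<close> is at most
  n/128, below all primes in \<open>primes_P n\<close>; the divisibility term therefore
  vanishes.\<close>

lemma dual_prob_small_freq:
  assumes n: "n \<ge> 2" and h: "h \<in> freqs" and small: "r h \<le> threshold n"
  shows "dual_prob n h \<le> 2 / real n"
proof -
  obtain j where j: "j \<in> supp d h" using supp_nonempty[OF h] by blast
  then have hj: "j \<in> {1..d}" "h j \<noteq> 0" by (auto simp: supp_def)
  have "\<bar>real_of_int (h j)\<bar> = \<bar>real_of_int (h j)\<bar> powr 1" by simp
  also have "\<dots> \<le> \<bar>real_of_int (h j)\<bar> powr (\<alpha> / lam)"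
    using hj exponent_gt_1 by (intro powr_mono) auto
  also have "\<dots> = (\<bar>real_of_int (h j)\<bar> powr \<alpha>) powr (1 / lam)"
    by (simp add: powr_powr)
  also have "\<dots> \<le> (V powr lam * threshold n) powr (1 / lam)"
  proof (rule powr_mono2)
    have "\<bar>real_of_int (h j)\<bar> powr \<alpha> \<le> V powr lam * r h" by (rule abs_powr_le_V_r[OF h j])
    also have "\<dots> \<le> V powr lam * threshold n" by (rule mult_left_mono[OF small]) simp
    finally show "\<bar>real_of_int (h j)\<bar> powr \<alpha> \<le> V powr lam * threshold n" .
  qed (use lam_gt in auto)
  also have "\<dots> = (V * (real n / (128 * V))) powr (lam * (1 / lam))"
    unfolding powr_powr[symmetric] using V_pos by (subst (2) powr_mult) auto
  also have "\<dots> = real n / 128" using V_pos lam_gt by simp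
  finally have le: "\<bar>real_of_int (h j)\<bar> \<le> real n / 128" .
  have "\<not> int p dvd h j" if "p \<in> primes_P n" for p
  proof
    assume "int p dvd h j"
    then have "\<bar>int p\<bar> \<le> \<bar>h j\<bar>" by (rule dvd_imp_le_int[OF hj(2)])
    then have "real p \<le> \<bar>real_of_int (h j)\<bar>" by linarith
    then show False using prime_in_primes_P(3)[OF that] le by simp
  qed
  then have "{p \<in> primes_P n. int p dvd h j} = {}" by auto
  then show ?thesis using prob_lattice_dual_le[OF n hj(1), of h]
    by (simp only: card.empty of_nat_0 div_0 add_0_left)
qed

text \<open>At most 2 ln |h_j| / ln n primes of \<open>primes_P n\<close> divide a nonzero
  coordinate, out of at least n / (8000 ln n). The factors ln n cancel, and ln |h_j| is absorbed
  into a small power of V^lam r(h) at the price 1/\<delta>.\<close>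

lemma dual_prob_le:
  assumes n: "n \<ge> 2" and h: "h \<in> freqs" and \<delta>: "0 < \<delta>"
  shows "dual_prob n h \<le> (2 + 16000 / \<delta>) / real n * (V powr lam * r h) powr (\<delta> / lam)"
proof -
  obtain j where j: "j \<in> supp d h" using supp_nonempty[OF h] by blast
  then have hj: "j \<in> {1..d}" "h j \<noteq> 0" by (auto simp: supp_def)
  define X where "X = V powr lam * r h"
  have absX: "\<bar>real_of_int (h j)\<bar> powr \<alpha> \<le> X" unfolding X_def by (rule abs_powr_le_V_r[OF h j])
  have "1 \<le> \<bar>real_of_int (h j)\<bar> powr \<alpha>" using lam_gt lam_less by (intro one_le_abs_powr[OF j]) auto
  with absX have X: "1 \<le> X" by linarith
  have \<delta>': "0 < \<delta> / lam" using \<delta> lam_gt by simp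
  have "ln (\<bar>real_of_int (h j)\<bar> powr \<alpha>) \<le> ln X"
    using absX X hj by (subst ln_le_cancel_iff) auto
  then have "\<alpha> * ln \<bar>real_of_int (h j)\<bar> \<le> ln X" using hj by (simp add: ln_powr)
  moreover have "lam * ln \<bar>real_of_int (h j)\<bar> \<le> \<alpha> * ln \<bar>real_of_int (h j)\<bar>"
    using lam_less hj by (intro mult_right_mono) auto
  moreover have "ln X \<le> X powr (\<delta> / lam) / (\<delta> / lam)"
    by (rule ln_powr_bound[OF X \<delta>'])
  ultimately have "lam * ln \<bar>real_of_int (h j)\<bar> \<le> X powr (\<delta> / lam) / (\<delta> / lam)"
    by linarith
  also have "\<dots> = lam * (X powr (\<delta> / lam) / \<delta>)" by simp
  finally have lnh: "ln \<bar>real_of_int (h j)\<bar> \<le> X powr (\<delta> / lam) / \<delta>"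
    using lam_gt by (subst (asm) mult_le_cancel_left_pos) auto
  define c where "c = real (card (primes_P n))"
  have c: "c > 0" unfolding c_def
    using primes_P_nonempty[OF n] finite_primes_P by (simp add: card_gt_0_iff)
  have lnn: "ln (real n) > 0" using n by simp
  have "real (card {p \<in> primes_P n. int p dvd h j}) / c
      \<le> (2 * ln \<bar>real_of_int (h j)\<bar> / ln (real n)) / c"
    using card_prime_divisors_le[OF n hj(2)] lnn c by (intro divide_right_mono) (auto simp: field_simps)
  also have "\<dots> = 2 * ln \<bar>real_of_int (h j)\<bar> * (1 / (c * ln (real n)))"
    by (simp add: field_simps)
  also have "\<dots> \<le> 2 * ln \<bar>real_of_int (h j)\<bar> * (8000 / real n)"
  proof (rule mult_left_mono)
    have "1 / (c * ln (real n)) \<le> 1 / (real n / 8000)"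
      using card_primes_P_ge[OF n] n c lnn unfolding c_def[symmetric]
      by (intro divide_left_mono) auto
    then show "1 / (c * ln (real n)) \<le> 8000 / real n" by simp
  qed (use hj in simp)
  also have "\<dots> \<le> 2 * (X powr (\<delta> / lam) / \<delta>) * (8000 / real n)"
    using lnh by (intro mult_right_mono mult_left_mono) auto
  finally have 1: "real (card {p \<in> primes_P n. int p dvd h j}) / c \<le> 16000 / \<delta> / real n * X powr (\<delta> / lam)"
    by (simp add: field_simps)
  \<comment> \<open>Since X \<ge> 1, the term 2/n can carry the same power.\<close>
  have "1 \<le> X powr (\<delta> / lam)" using X \<delta>' by (intro ge_one_powr_ge_zero) auto
  then have "2 / real n * 1 \<le> 2 / real n * X powr (\<delta> / lam)"
    by (rule mult_left_mono) simp
  with 1 prob_lattice_dual_le[OF n hj(1), of h] show ?thesis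
    unfolding X_def[symmetric] c_def[symmetric] by (simp add: add_divide_distrib distrib_right)
qed

section \<open>Rarity of bad lattices and the worst-case error\<close>

text \<open>Markov-type count: each member contributes at least t^(-1/lam) to a sum that is at most
  \<open>V\<close>.\<close>

lemma card_freqs_le:
  assumes "finite F" "F \<subseteq> {h \<in> freqs. r h \<le> t}" "0 < t"
  shows "real (card F) \<le> V * t powr (1 / lam)"
proof -
  have "real (card F) * t powr (- (1 / lam)) = (\<Sum>h\<in>F. t powr (- (1 / lam)))" by simp
  also have "\<dots> \<le> (\<Sum>h\<in>F. r h powr (- (1 / lam)))"
    using assms(2) lam_gt r_pos by (intro sum_mono powr_mono2') auto
  also have "\<dots> \<le> V"
    using assms by (intro sum_r_powr_le_V) auto
  finally show ?thesis
    using assms(3) by (simp add: powr_minus_divide field_simps)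
qed

lemma finite_small_freqs:
  assumes "0 < t"
  shows "finite {h \<in> freqs. r h \<le> t}"
proof -
  have "card F \<le> nat \<lfloor>V * t powr (1 / lam)\<rfloor>" if "F \<subseteq> {h \<in> freqs. r h \<le> t}" "finite F" for F
    by (rule le_nat_floor[OF card_freqs_le[OF that(2,1) assms]])
  then show ?thesis by (rule finite_if_finite_subsets_card_bdd[THEN conjunct1])
qed

text \<open>Union bound over at most n/128 small frequencies, each dual with probability at most
  2/n. The value 1/64 is what the median estimate asks for.\<close>

lemma prob_bad_lattice_le:
  assumes n: "n \<ge> 2"
  shows "measure_pmf.prob (pair_pmf_n n d) {x. bad_lattice (threshold n) x} \<le> 1 / 64"
proof -
  let ?t = "threshold n" and ?H = "{h \<in> freqs. r h \<le> threshold n}"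
  have t: "?t > 0" using n V_pos by simp
  have fin: "finite ?H" by (rule finite_small_freqs[OF t])
  have "{x. bad_lattice ?t x} = (\<Union>h\<in>?H. {x. h \<in> lattice_dual d (fst x) (snd x)})"
    by (auto simp: bad_lattice_def)
  then have "measure_pmf.prob (pair_pmf_n n d) {x. bad_lattice ?t x} \<le> (\<Sum>h\<in>?H. dual_prob n h)"
    using fin by (simp only:) (rule measure_pmf.finite_measure_subadditive_finite, auto)
  also have "\<dots> \<le> (\<Sum>h\<in>?H. 2 / real n)"
    by (rule sum_mono) (use dual_prob_small_freq[OF n] in blast)
  also have "\<dots> = real (card ?H) * (2 / real n)" by simp
  also have "\<dots> \<le> (V * ?t powr (1 / lam)) * (2 / real n)"
    by (intro mult_right_mono card_freqs_le fin t) auto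
  also have "?t powr (1 / lam) = real n / (128 * V)"
    using lam_gt V_pos n by (simp add: powr_powr)
  also have "V * (real n / (128 * V)) * (2 / real n) = 1 / 64"
    using V_pos n by simp
  finally show ?thesis .
qed

text \<open>Cauchy-Schwarz with w = 1. It supplies the uniform bound \<open>E\<close> of the median
  estimate, where it is damped by 2^(-K).\<close>

lemma lattice_rule_error_le_norm:
  assumes f: "in_korobov d \<alpha> \<gamma> f" and p: "p > 0"
  shows "cmod (I_d d f - lattice_rule d p z f) \<le> korobov_norm d \<alpha> \<gamma> f * V powr lam"
proof -
  note lattice_rule_error_le(1)[OF f p, of z]
  also have "(\<Sum>\<^sub>\<infinity>h\<in>freqs. if h \<in> lattice_dual d p z then cmod (fourier_coeff d f h) else 0)
      \<le> korobov_norm d \<alpha> \<gamma> f * V powr lam"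
  proof (rule infsum_le_finite_sums[OF lattice_rule_error_le(2)[OF f p]])
    fix F assume F: "finite F" "F \<subseteq> freqs"
    have "(\<Sum>h\<in>F. if h \<in> lattice_dual d p z then cmod (fourier_coeff d f h) else 0)
        \<le> (\<Sum>h\<in>F. cmod (fourier_coeff d f h) * 1)"
      by (rule sum_mono) simp
    also have "\<dots> \<le> korobov_norm d \<alpha> \<gamma> f * V powr lam"
    proof (rule sum_fourier_coeff_le[OF f F])
      have "(V powr lam)\<^sup>2 = V powr (2 * lam)"
        by (simp add: power2_eq_square flip: powr_add)
      then show "(\<Sum>h\<in>F. (1 / r h)\<^sup>2) \<le> (V powr lam)\<^sup>2"
        using sum_inverse_r_squared_le[OF F] by simp
    qed auto
    finally show "(\<Sum>h\<in>F. if h \<in> lattice_dual d p z then cmod (fourier_coeff d f h) else 0)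
        \<le> korobov_norm d \<alpha> \<gamma> f * V powr lam" .
  qed
  finally show ?thesis .
qed

section \<open>Mean error on good lattices\<close>

text \<open>The Cauchy-Schwarz factor belonging to the duality probabilities above the threshold;
  the power of 128 stems from the threshold.\<close>

definition rate :: "real \<Rightarrow> nat \<Rightarrow> real" where
  "rate \<delta> n = (2 + 16000 / \<delta>) * 128 powr (lam - \<delta> - 1/2) * V powr lam * real n powr (- lam - 1/2 + \<delta>)"

text \<open>Exponent bookkeeping: the power of the threshold is (n/(128 V))^e with e = 2\<delta> - 2
  lam + 1, so V collects 2\<delta> - e + 1 = 2 lam and n collects e - 2 = 2(\<delta> - lam -
  1/2).\<close>

lemma rate_squared:
  assumes n: "n \<ge> 2" and \<delta>: "0 < \<delta>"
  shows "(rate \<delta> n)\<^sup>2 = ((2 + 16000 / \<delta>) / real n)\<^sup>2 * V powr (2 * \<delta>)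
      * threshold n powr (2 * (\<delta> / lam) - 2 + 1 / lam) * V"
proof -
  define C where "C = 2 + 16000 / \<delta>"
  define e where "e = 2 * \<delta> - 2 * lam + 1"
  have "threshold n powr (2 * (\<delta> / lam) - 2 + 1 / lam) = (real n / (128 * V)) powr e"
  proof -
    have "lam * (2 * (\<delta> / lam) - 2 + 1 / lam) = e"
      using lam_gt by (simp add: e_def distrib_left right_diff_distrib)
    then show ?thesis by (simp only: powr_powr)
  qed
  also have "\<dots> = real n powr e * 128 powr (- e) * V powr (- e)"
    using V_pos n by (simp add: powr_divide powr_mult powr_minus field_simps)
  finally have "(C / real n)\<^sup>2 * V powr (2 * \<delta>) * threshold n powr (2 * (\<delta> / lam) - 2 + 1 / lam) * V
      = C\<^sup>2 * 128 powr (- e) * (V powr (2 * \<delta>) * V powr (- e) * V powr 1) * (real n powr (- 2) * real n powr e)"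
    using V_pos n by (simp add: powr_minus_divide power_divide field_simps)
  also have "\<dots> = C\<^sup>2 * 128 powr (- e) * V powr (2 * lam) * real n powr (- 2 * lam - 1 + 2 * \<delta>)"
    unfolding powr_add[symmetric] by (simp add: e_def algebra_simps)
  also have "\<dots> = (C * 128 powr (lam - \<delta> - 1/2) * V powr lam * real n powr (- lam - 1/2 + \<delta>))\<^sup>2"
  proof -
    have sq: "(x powr a)\<^sup>2 = x powr (2 * a)" for x a :: real
      by (simp add: power2_eq_square flip: powr_add)
    show ?thesis unfolding power_mult_distrib sq by (simp add: e_def algebra_simps)
  qed
  finally show ?thesis by (simp only: rate_def C_def)
qed

text \<open>Averaging over lattices before summing over frequencies replaces the indicator of
  duality by its probability. Only frequencies above the threshold remain, and Cauchy-Schwarz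
  applies with these probabilities as weights.\<close>

lemma expectation_good_lattice_le:
  assumes f: "in_korobov d \<alpha> \<gamma> f" and n: "n \<ge> 2" and \<delta>: "0 < \<delta>" "\<delta> < lam - 1/2"
  shows "measure_pmf.expectation (pair_pmf_n n d)
      (\<lambda>x. if bad_lattice (threshold n) x then 0 else cmod (I_d d f - lattice_rule d (fst x) (snd x) f))
    \<le> korobov_norm d \<alpha> \<gamma> f * rate \<delta> n"
proof -
  let ?q = "pair_pmf_n n d" and ?t = "threshold n"
  let ?S = "set_pmf (pair_pmf_n n d)"
  let ?G = "\<lambda>x. if bad_lattice ?t x then 0 else cmod (I_d d f - lattice_rule d (fst x) (snd x) f)"
  let ?a = "\<lambda>x h. if h \<in> lattice_dual d (fst x) (snd x) then cmod (fourier_coeff d f h) else 0"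
  \<comment> \<open>On a good lattice the cut-off removes only zeros; on a bad one nonnegativity of
    \<open>g\<close> suffices. This frees the sum from the event of being good.\<close>
  define g where "g = (\<lambda>x h. if ?t < r h then ?a x h else 0)"
  define w where "w = (\<lambda>h. if ?t < r h then dual_prob n h else 0)"
  have t: "?t > 0" using n V_pos by simp
  have finS: "finite ?S" by (rule set_pair_pmf_n[OF n])
  have p: "fst x > 0" if "x \<in> ?S" for x
    using set_pair_pmf_n(2)[OF n that] prime_in_primes_P(1) prime_gt_0_nat by blast
  have summ: "g x summable_on freqs" if "x \<in> ?S" for x
    using lattice_rule_error_le(2)[OF f p[OF that], of "snd x"]
    by (rule summable_on_comparison_test) (auto simp: g_def)
  have G_le: "?G x \<le> infsum (g x) freqs" if x: "x \<in> ?S" for x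
  proof (cases "bad_lattice ?t x")
    case True
    have "0 \<le> g x h" for h by (simp add: g_def)
    then show ?thesis using True by (simp add: infsum_nonneg)
  next
    case False
    then have "?a x h = g x h" if "h \<in> freqs" for h
      using that by (auto simp: g_def bad_lattice_def)
    then have "infsum (?a x) freqs = infsum (g x) freqs" by (rule infsum_cong)
    then show ?thesis
      using lattice_rule_error_le(1)[OF f p[OF x], of "snd x"] False by simp
  qed
  \<comment> \<open>The support is finite, so the mean and the infinite sum interchange.\<close>
  have "((\<lambda>h. \<Sum>x\<in>?S. g x h * pmf ?q x) has_sum (\<Sum>x\<in>?S. infsum (g x) freqs * pmf ?q x)) freqs"
    using summ by (intro has_sum_finite_sum has_sum_cmult_left has_sum_infsum)
  then have "(\<Sum>x\<in>?S. infsum (g x) freqs * pmf ?q x) \<le> korobov_norm d \<alpha> \<gamma> f * rate \<delta> n"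
  proof (rule has_sum_le_finite_sums)
    fix F assume F: "finite F" "F \<subseteq> freqs"
    have "(\<Sum>x\<in>?S. g x h * pmf ?q x) = cmod (fourier_coeff d f h) * w h" for h
    proof -
      have "dual_prob n h = measure_pmf.expectation ?q (indicator {x. h \<in> lattice_dual d (fst x) (snd x)})"
        by simp
      also have "\<dots> = (\<Sum>x\<in>?S. indicator {x. h \<in> lattice_dual d (fst x) (snd x)} x * pmf ?q x)"
        by (rule integral_measure_pmf_real[OF finS])
      finally have "cmod (fourier_coeff d f h) * dual_prob n h
          = (\<Sum>x\<in>?S. ?a x h * pmf ?q x)"
        by (simp add: sum_distrib_left indicator_def) (intro sum.cong, auto)
      then show ?thesis by (simp add: g_def w_def)
    qed
    then have "(\<Sum>h\<in>F. \<Sum>x\<in>?S. g x h * pmf ?q x) = (\<Sum>h\<in>F. cmod (fourier_coeff d f h) * w h)" by simp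
    also have "\<dots> \<le> korobov_norm d \<alpha> \<gamma> f * rate \<delta> n"
    proof (rule sum_fourier_coeff_le[OF f F])
      let ?C = "(2 + 16000 / \<delta>) / real n" and ?e = "2 * (\<delta> / lam) - 2 + 1 / lam"
      \<comment> \<open>Here \<delta> < lam - 1/2 enters: with a negative exponent, the power of
        \<open>r h\<close> above the threshold is bounded by its value at the threshold.\<close>
      have e: "?e < 0" using \<delta> lam_gt by (simp add: field_simps)
      have "(w h / r h)\<^sup>2 \<le> ?C\<^sup>2 * V powr (2 * \<delta>) * ?t powr ?e * r h powr (- (1 / lam))" if h: "h \<in> F" for h
      proof (cases "?t < r h")
        case True
        have "w h \<le> ?C * (V powr lam * r h) powr (\<delta> / lam)"
          using dual_prob_le[OF n _ \<delta>(1), of h] h F True by (auto simp: w_def)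
        also have "\<dots> = ?C * (V powr \<delta> * r h powr (\<delta> / lam))"
          using lam_gt V_pos r_pos[of h] by (simp add: powr_mult powr_powr)
        finally have "w h / r h \<le> ?C * (V powr \<delta> * r h powr (\<delta> / lam)) / r h"
          using r_pos[of h] by (intro divide_right_mono) auto
        then have "(w h / r h)\<^sup>2 \<le> (?C * (V powr \<delta> * r h powr (\<delta> / lam)) / r h)\<^sup>2"
          using r_pos[of h] by (intro power_mono) (auto simp: w_def intro!: divide_nonneg_pos)
        also have "\<dots> = ?C\<^sup>2 * V powr (2 * \<delta>) * (r h powr (2 * (\<delta> / lam)) * r h powr (- 2))"
        proof -
          have sq: "(x powr a)\<^sup>2 = x powr (2 * a)" for x a :: real
            by (simp add: power2_eq_square flip: powr_add)
          have "r h powr (- 2) = 1 / (r h)\<^sup>2" using r_pos[of h] by (simp add: powr_minus_divide)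
          then show ?thesis unfolding power_divide power_mult_distrib sq by simp
        qed
        \<comment> \<open>One factor r(h)^(-1/lam) is reserved for the sum over frequencies, which
          \<open>V\<close> bounds.\<close>
        also have "r h powr (2 * (\<delta> / lam)) * r h powr (- 2) = r h powr ?e * r h powr (- (1 / lam))"
          by (simp flip: powr_add)
        also have "\<dots> \<le> ?t powr ?e * r h powr (- (1 / lam))"
          using e t True by (intro mult_right_mono powr_mono2') auto
        finally show ?thesis by (simp add: mult_left_mono mult.assoc)
      next
        case False
        then show ?thesis by (simp add: w_def)
      qed
      then have "(\<Sum>h\<in>F. (w h / r h)\<^sup>2)
          \<le> (\<Sum>h\<in>F. ?C\<^sup>2 * V powr (2 * \<delta>) * ?t powr ?e * r h powr (- (1 / lam)))"
        by (rule sum_mono)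
      also have "\<dots> \<le> ?C\<^sup>2 * V powr (2 * \<delta>) * ?t powr ?e * V"
        unfolding sum_distrib_left[symmetric]
        by (intro mult_left_mono sum_r_powr_le_V F) auto
      finally show "(\<Sum>h\<in>F. (w h / r h)\<^sup>2) \<le> (rate \<delta> n)\<^sup>2"
        unfolding rate_squared[OF n \<delta>(1)] .
    qed (use \<delta> in \<open>auto simp: w_def rate_def\<close>)
    finally show "(\<Sum>h\<in>F. \<Sum>x\<in>?S. g x h * pmf ?q x) \<le> korobov_norm d \<alpha> \<gamma> f * rate \<delta> n" .
  qed
  moreover have "measure_pmf.expectation ?q ?G = (\<Sum>x\<in>?S. ?G x * pmf ?q x)"
    by (rule integral_measure_pmf_real[OF finS])
  moreover have "(\<Sum>x\<in>?S. ?G x * pmf ?q x) \<le> (\<Sum>x\<in>?S. infsum (g x) freqs * pmf ?q x)"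
    by (intro sum_mono mult_right_mono G_le) auto
  ultimately show ?thesis by linarith
qed

section \<open>Assembling the error of the median\<close>

lemma expectation_median_alg_le:
  assumes f: "in_korobov d \<alpha> \<gamma> f" and n: "n \<ge> 2" and \<delta>: "0 < \<delta>" "\<delta> < lam - 1/2"
    and h: "h n \<ge> lam + 1/2"
  shows "measure_pmf.expectation (samples_pmf h n d) (\<lambda>\<omega>. cmod (I_d d f - median_alg h n d \<omega> f))
    \<le> (8 * (2 + 16000 / \<delta>) * 128 powr (lam - \<delta> - 1/2) + 1) * V powr lam
         * real n powr (- lam - 1/2 + \<delta>) * korobov_norm d \<alpha> \<gamma> f"
proof -
  define K where "K = nat \<lceil>h n * log 2 (real n)\<rceil>"
  have norm: "0 \<le> korobov_norm d \<alpha> \<gamma> f"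
    by (auto simp: korobov_norm_def intro!: infsum_nonneg)
  have "measure_pmf.expectation (samples_pmf h n d) (\<lambda>\<omega>. cmod (I_d d f - median_alg h n d \<omega> f))
      \<le> 8 * (korobov_norm d \<alpha> \<gamma> f * rate \<delta> n) + korobov_norm d \<alpha> \<gamma> f * V powr lam / 2 ^ K"
    unfolding samples_pmf_def median_alg_def num_reps_def K_def[symmetric]
  proof (rule expectation_median_deviation_le[where Q = "\<lambda>x. lattice_rule d (fst x) (snd x) f"
        and bad = "bad_lattice (threshold n)"])
    show "finite (set_pmf (pair_pmf_n n d))" by (rule set_pair_pmf_n[OF n])
    show "cmod (I_d d f - lattice_rule d (fst x) (snd x) f) \<le> korobov_norm d \<alpha> \<gamma> f * V powr lam"
      if "x \<in> set_pmf (pair_pmf_n n d)" for x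
      using set_pair_pmf_n(2)[OF n that] prime_in_primes_P(1) prime_gt_0_nat
      by (intro lattice_rule_error_le_norm[OF f]) blast
  qed (rule prob_bad_lattice_le[OF n] expectation_good_lattice_le[OF f n \<delta>])+
  also have "korobov_norm d \<alpha> \<gamma> f * V powr lam / 2 ^ K
      \<le> korobov_norm d \<alpha> \<gamma> f * V powr lam * real n powr (- lam - 1/2 + \<delta>)"
  proof -
    \<comment> \<open>The lower bound on \<open>h n\<close> enters here: K \<ge> h(n) log2 n makes
      2^(-K) at most the target power of \<open>n\<close>.\<close>
    have "(lam + 1/2 - \<delta>) * log 2 (real n) \<le> h n * log 2 (real n)"
      using h \<delta> n by (intro mult_right_mono) auto
    also have "\<dots> \<le> real K" unfolding K_def by linarith
    finally have "2 powr ((lam + 1/2 - \<delta>) * log 2 (real n)) \<le> 2 powr real K"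
      by (intro powr_mono) auto
    moreover have "2 powr ((lam + 1/2 - \<delta>) * log 2 (real n)) = (2 powr log 2 (real n)) powr (lam + 1/2 - \<delta>)"
      by (simp add: powr_powr mult.commute)
    ultimately have "real n powr (lam + 1/2 - \<delta>) \<le> 2 ^ K"
      using n by (simp add: powr_realpow)
    then have "1 / 2 ^ K \<le> 1 / real n powr (lam + 1/2 - \<delta>)"
      using n by (intro divide_left_mono) auto
    also have "\<dots> = real n powr (- lam - 1/2 + \<delta>)"
      by (simp add: algebra_simps flip: powr_minus_divide)
    finally have "korobov_norm d \<alpha> \<gamma> f * V powr lam * (1 / 2 ^ K)
        \<le> korobov_norm d \<alpha> \<gamma> f * V powr lam * real n powr (- lam - 1/2 + \<delta>)"
      using norm by (intro mult_left_mono) auto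
    then show ?thesis by simp
  qed
  finally show ?thesis
    unfolding rate_def by (simp add: algebra_simps)
qed

end

theorem mainTheorem5:
  fixes lam \<delta> :: real
  assumes "1/2 < lam" and "0 < \<delta>" and "\<delta> < min (lam - 1/2) 1"
  shows "\<exists>C>0. \<forall>(h :: nat \<Rightarrow> real) (\<alpha> :: real) (\<gamma> :: nat set \<Rightarrow> real) (d :: nat)
            (f :: (nat \<Rightarrow> real) \<Rightarrow> complex) (n :: nat).
      (\<forall>m. 1 \<le> h m) \<longrightarrow> filterlim h at_top at_top \<longrightarrow>
      1/2 < \<alpha> \<longrightarrow> lam < \<alpha> \<longrightarrow>
      (\<forall>u. finite u \<longrightarrow> 0 < \<gamma> u \<and> \<gamma> u \<le> 1) \<longrightarrow> \<gamma> {} = 1 \<longrightarrow>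
      1 \<le> d \<longrightarrow>
      in_korobov d \<alpha> \<gamma> f \<longrightarrow>
      2 \<le> n \<longrightarrow>
      real n \<ge> 64 * V_d d (\<alpha> / lam) (\<lambda>u. \<gamma> u powr (1 / lam)) \<longrightarrow>
      h n \<ge> lam + 1/2 \<longrightarrow>
      measure_pmf.expectation (samples_pmf h n d) (\<lambda>\<omega>. cmod (I_d d f - median_alg h n d \<omega> f))
        \<le> C * V_d d (\<alpha> / lam) (\<lambda>u. \<gamma> u powr (1 / lam)) powr lam
             * real n powr (- lam - 1/2 + \<delta>) * korobov_norm d \<alpha> \<gamma> f"
proof -
  \<comment> \<open>Eight times the constant in \<open>rate\<close>, from averaging good samples,
    plus 1 for the event that too many samples are bad; only \<open>lam\<close> and \<delta>
    occur.\<close>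
  let ?C = "8 * (2 + 16000 / \<delta>) * 128 powr (lam - \<delta> - 1/2) + 1"
  have "0 < ?C" using assms by (intro add_nonneg_pos) auto
  then show ?thesis
  proof (intro exI[of _ ?C] conjI allI impI)
    fix h :: "nat \<Rightarrow> real" and \<alpha> :: real and \<gamma> :: "nat set \<Rightarrow> real" and d n :: nat
      and f :: "(nat \<Rightarrow> real) \<Rightarrow> complex"
    assume *: "lam < \<alpha>" "\<forall>u. finite u \<longrightarrow> 0 < \<gamma> u \<and> \<gamma> u \<le> 1" "1 \<le> d"
      "in_korobov d \<alpha> \<gamma> f" "2 \<le> n" "lam + 1/2 \<le> h n"
    interpret korobov_weights d \<alpha> \<gamma> lam
      using assms * by unfold_locales auto
    show "measure_pmf.expectation (samples_pmf h n d) (\<lambda>\<omega>. cmod (I_d d f - median_alg h n d \<omega> f))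
        \<le> ?C * V powr lam * real n powr (- lam - 1/2 + \<delta>) * korobov_norm d \<alpha> \<gamma> f"
      using assms * by (intro expectation_median_alg_le) auto
  qed
qed

end
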